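(* Let $\Omega\subset\mathbb{R}^n$ be open, $Y$ be a separable Banach space, and $p\in[1,\infty)$. Then $$W^{1,p}_*(\Omega;Y^* )=R^{1,p}(\Omega;Y^* ).$$
   Context: Banach spaces are real and $\langle\cdot,\cdot\rangle$ denotes the duality pairing. Let $V$ be a Banach space with dual $V^*$. $f\colon\Omega\to V$ is measurable if it is measurable with respect to the Borel $\sigma$-algebra on $V$ and the Lebesgue measurable subsets of $\Omega$; it is essentially separably valued if there is a null set $N\subset\Omega$ with $f(\Omega\setminus N)$ separable. $L^p(\Omega;V)$ consists of those $f\colon\Omega\to V$ that are measurable and essentially separably valued and for which $x\mapsto\|f(x)\|$ lies in $L^p(\Omega)$. $f\colon\Omega\to V^*$ is weak* measurable if $x\mapsto\langle v,f(x)\rangle$ is measurable for every $v\in V$. $L^p_*(\Omega;V^* )$ consists of those $f\colon\Omega\to V^*$ that are weak* measurable and for which $x\mapsto\|f(x)\|$ lies in $L^p(\Omega)$. Gelfand integral: if $f\colon\Omega\to V^*$ is weak* measurable and $\langle v,f\rangle\in L^1(\Omega)$ for every $v\in V$, then the Gelfand integral $\int_\Omega f(x)\,dx$ is the unique element of $V^*$ with $\langle v,\int_\Omega f(x)\,dx\rangle=\int_\Omega\langle v,f(x)\rangle\,dx$ for every $v\in V$. $W^{1,p}_*(\Omega;V^* )$ consists of those $f\in L^p(\Omega;V^* )$ such that for every $j=1,\dots,n$ there is $f_j\in L^p_*(\Omega;V^* )$ with $$\int_\Omega\frac{\partial\varphi}{\partial x_j}(x)\, f(x)\,dx=-\int_\Omega\varphi(x)\,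 f_j(x)\,dx\quad\text{for every }\varphi\in C^\infty_0(\Omega)$$ in the sense of Gelfand integrals ($C^\infty_0(\Omega)$: smooth real functions with compact support in $\Omega$). The Reshetnyak–Sobolev space $R^{1,p}(\Omega;V)$ consists of those $f\in L^p(\Omega;V)$ such that: (A) for every $v^*\in V^*$ the function $x\mapsto\langle v^*,f(x)\rangle$ lies in the classical Sobolev space $W^{1,p}(\Omega)=W^{1,p}(\Omega;\mathbb{R})$; (B) there is $g\in L^p(\Omega)$ such that for every $v^*\in V^*$ one has $|\nabla\langle v^*,f(x)\rangle|\le\|v^*\|\cdot g(x)$ for a.e. $x\in\Omega$ (weak gradient, Euclidean norm). In the claim, $R^{1,p}(\Omega;Y^* )$ is this space for the Banach space $Y^*$, so condition (A) and (B) range over functionals in $Y^{**}$. *)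

theory Defs
  imports "HOL-Analysis.Analysis"
begin

text \<open>Elements of the function spaces below are total functions of which only the values on
  \<open>\<Omega>\<close> matter; as usual for Lebesgue spaces defined pointwise, functions agreeing almost
  everywhere are not identified. The dual of \<open>'v\<close> is the Banach space of bounded linear maps
  \<open>'v \<Rightarrow>\<^sub>L real\<close> with the operator norm.\<close>

subsection \<open>Test functions\<close>

definition partial_deriv :: "'n::finite \<Rightarrow> (real^'n \<Rightarrow> real) \<Rightarrow> real^'n \<Rightarrow> real" where
  "partial_deriv j f x = frechet_derivative f (at x) (axis j 1)"

primrec k_times_cont_diff :: "nat \<Rightarrow> (real^'n::finite \<Rightarrow> real) \<Rightarrow> bool" where
  "k_times_cont_diff 0 f \<longleftrightarrow> continuous_on UNIV f"
| "k_times_cont_diff (Suc k) f \<longleftrightarrow>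
     (\<forall>x. f differentiable (at x)) \<and> (\<forall>j. k_times_cont_diff k (partial_deriv j f))"

definition smooth_fun :: "(real^'n::finite \<Rightarrow> real) \<Rightarrow> bool" where
  "smooth_fun f \<longleftrightarrow> (\<forall>k. k_times_cont_diff k f)"

text \<open>A smooth function with compact support in the open set \<open>\<Omega>\<close> is represented by its
  (smooth) extension by zero to the whole space.\<close>

definition test_functions :: "(real^'n::finite) set \<Rightarrow> (real^'n \<Rightarrow> real) set" where
  "test_functions \<Omega> = {\<phi>. smooth_fun \<phi> \<and>
     compact (closure {x. \<phi> x \<noteq> 0}) \<and> closure {x. \<phi> x \<noteq> 0} \<subseteq> \<Omega>}"

subsection \<open>Lebesgue spaces\<close>

definition Lp_real :: "(real^'n::finite) set \<Rightarrow> real \<Rightarrow> (real^'n \<Rightarrow> real) set" where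
  "Lp_real \<Omega> p = {h. h \<in> borel_measurable (lebesgue_on \<Omega>) \<and>
     integrable (lebesgue_on \<Omega>) (\<lambda>x. \<bar>h x\<bar> powr p)}"

definition essentially_separably_valued ::
  "(real^'n::finite) set \<Rightarrow> (real^'n \<Rightarrow> 'v::topological_space) \<Rightarrow> bool" where
  "essentially_separably_valued \<Omega> f \<longleftrightarrow>
     (\<exists>N \<in> null_sets (lebesgue_on \<Omega>). separable_space (top_of_set (f ` (\<Omega> - N))))"

definition Lp :: "(real^'n::finite) set \<Rightarrow> real \<Rightarrow> (real^'n \<Rightarrow> 'v::real_normed_vector) set" where
  "Lp \<Omega> p = {f. f \<in> borel_measurable (lebesgue_on \<Omega>) \<and>
     essentially_separably_valued \<Omega> f \<and> (\<lambda>x. norm (f x)) \<in> Lp_real \<Omega> p}"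

definition weak_star_measurable ::
  "(real^'n::finite) set \<Rightarrow> (real^'n \<Rightarrow> ('v::real_normed_vector \<Rightarrow>\<^sub>L real)) \<Rightarrow> bool" where
  "weak_star_measurable \<Omega> f \<longleftrightarrow>
     (\<forall>v. (\<lambda>x. blinfun_apply (f x) v) \<in> borel_measurable (lebesgue_on \<Omega>))"

definition Lp_star ::
  "(real^'n::finite) set \<Rightarrow> real \<Rightarrow> (real^'n \<Rightarrow> ('v::real_normed_vector \<Rightarrow>\<^sub>L real)) set" where
  "Lp_star \<Omega> p = {f. weak_star_measurable \<Omega> f \<and> (\<lambda>x. norm (f x)) \<in> Lp_real \<Omega> p}"

subsection \<open>The Gelfand integral\<close>

definition has_gelfand_integral ::
  "(real^'n::finite \<Rightarrow> ('v::real_normed_vector \<Rightarrow>\<^sub>L real)) \<Rightarrow> ('v \<Rightarrow>\<^sub>L real) \<Rightarrow>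
     (real^'n) set \<Rightarrow> bool" where
  "has_gelfand_integral f w \<Omega> \<longleftrightarrow> weak_star_measurable \<Omega> f \<and>
     (\<forall>v. integrable (lebesgue_on \<Omega>) (\<lambda>x. blinfun_apply (f x) v) \<and>
          blinfun_apply w v = (\<integral>x. blinfun_apply (f x) v \<partial>lebesgue_on \<Omega>))"

lemma has_gelfand_integral_unique:
  "has_gelfand_integral f w \<Omega> \<Longrightarrow> has_gelfand_integral f w' \<Omega> \<Longrightarrow> w = w'"
  by (simp add: has_gelfand_integral_def blinfun_eqI)

subsection \<open>Sobolev spaces\<close>

definition locally_integrable :: "(real^'n::finite) set \<Rightarrow> (real^'n \<Rightarrow> real) \<Rightarrow> bool" where
  "locally_integrable \<Omega> h \<longleftrightarrow>
     (\<forall>K. compact K \<and> K \<subseteq> \<Omega> \<longrightarrow> integrable (lebesgue_on K) h)"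

text \<open>The weak gradient is unique only up to null sets, so it is a relation between \<open>h\<close> and a
  representative \<open>G\<close>.\<close>

definition has_weak_gradient ::
  "(real^'n::finite \<Rightarrow> real) \<Rightarrow> (real^'n \<Rightarrow> real^'n) \<Rightarrow> (real^'n) set \<Rightarrow> bool" where
  "has_weak_gradient h G \<Omega> \<longleftrightarrow> locally_integrable \<Omega> h \<and>
     (\<forall>j. locally_integrable \<Omega> (\<lambda>x. G x $ j) \<and>
       (\<forall>\<phi>\<in>test_functions \<Omega>.
          (\<integral>x. partial_deriv j \<phi> x * h x \<partial>lebesgue_on \<Omega>) =
          - (\<integral>x. \<phi> x * G x $ j \<partial>lebesgue_on \<Omega>)))"

definition sobolev_W1p :: "(real^'n::finite) set \<Rightarrow> real \<Rightarrow> (real^'n \<Rightarrow> real) set" where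
  "sobolev_W1p \<Omega> p = {h. h \<in> Lp_real \<Omega> p \<and>
     (\<exists>G. has_weak_gradient h G \<Omega> \<and> (\<forall>j. (\<lambda>x. G x $ j) \<in> Lp_real \<Omega> p))}"

definition sobolev_W1p_star ::
  "(real^'n::finite) set \<Rightarrow> real \<Rightarrow> (real^'n \<Rightarrow> ('v::real_normed_vector \<Rightarrow>\<^sub>L real)) set" where
  "sobolev_W1p_star \<Omega> p = {f. f \<in> Lp \<Omega> p \<and>
     (\<forall>j. \<exists>fj \<in> Lp_star \<Omega> p. \<forall>\<phi>\<in>test_functions \<Omega>. \<exists>I J.
        has_gelfand_integral (\<lambda>x. partial_deriv j \<phi> x *\<^sub>R f x) I \<Omega> \<and>
        has_gelfand_integral (\<lambda>x. \<phi> x *\<^sub>R fj x) J \<Omega> \<and> I = - J)}"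

definition reshetnyak_sobolev_R1p ::
  "(real^'n::finite) set \<Rightarrow> real \<Rightarrow> (real^'n \<Rightarrow> 'v::real_normed_vector) set" where
  "reshetnyak_sobolev_R1p \<Omega> p = {f. f \<in> Lp \<Omega> p \<and>
     (\<forall>vs :: 'v \<Rightarrow>\<^sub>L real. (\<lambda>x. blinfun_apply vs (f x)) \<in> sobolev_W1p \<Omega> p) \<and>
     (\<exists>g \<in> Lp_real \<Omega> p. \<forall>vs :: 'v \<Rightarrow>\<^sub>L real.
        \<exists>G. has_weak_gradient (\<lambda>x. blinfun_apply vs (f x)) G \<Omega> \<and>
          (AE x in lebesgue_on \<Omega>. norm (G x) \<le> norm vs * g x))}"

end

theory Submission
  imports Defs
begin

text \<open>Let \<open>f\<close> be in \<open>L\<^sup>p\<close> with values in the dual of a separable space \<open>Y\<close>.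

  Suppose that \<open>f\<close> has weak* partial derivatives \<open>fj\<close>. The difficulty is that condition (A) asks for
  weak derivatives of \<open>\<langle>v\<^sup>*\<^sup>*, f\<rangle>\<close> for functionals \<open>v\<^sup>*\<^sup>*\<close> from the bidual, whereas \<open>\<langle>v\<^sup>*\<^sup>*, fj\<rangle>\<close> need not even be
  measurable. But \<open>v\<^sup>*\<^sup>*\<close> can be applied to the Gelfand integrals of \<open>\<psi> fj\<close>, and as a functional of the
  scalar function \<open>\<psi>\<close> this is bounded on \<open>L\<^sup>1\<close> with weight \<open>norm fj\<close>. By the duality of \<open>L\<^sup>1\<close> and
  \<open>L\<^sup>\<infinity>\<close> (lemma \<open>weighted_L1_functional_density\<close>, a consequence of the Radon-Nikodym theorem) it is
  integration against a function \<open>h\<close> with \<open>\<bar>h\<bar> \<le> norm v\<^sup>*\<^sup>* * norm fj\<close>. On test functions the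
  functional equals minus the integral of \<open>\<partial>\<^sub>j\<phi> \<langle>v\<^sup>*\<^sup>*, f\<rangle>\<close>, because \<open>v\<^sup>*\<^sup>*\<close> commutes with Gelfand integrals
  of essentially separably valued maps (lemma \<open>bidual_commutes_with_gelfand_integral\<close>). So \<open>h\<close> is the
  weak partial derivative of \<open>\<langle>v\<^sup>*\<^sup>*, f\<rangle>\<close>, and the bound needed for condition (B) comes with it.

  Conversely, let \<open>f\<close> be in the Reshetnyak-Sobolev space and let \<open>D v\<close> be a weak partial derivative of
  \<open>\<langle>v, f\<rangle>\<close> for \<open>v\<close> in \<open>Y\<close>. Weak derivatives are unique up to null sets, by the fundamental lemma of the
  calculus of variations, so \<open>D v\<close> is linear in \<open>v\<close> and bounded by \<open>norm v * g\<close> almost everywhere,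
  with exceptional sets depending on the vectors. On a countable dense rational subspace of \<open>Y\<close> one null
  set suffices, and outside of it the values \<open>D v x\<close> extend to an element \<open>fj x\<close> of the dual (lemma
  \<open>weak_star_density_selection\<close>), which is the required weak* derivative.\<close>

section \<open>Functionals on weighted integrable functions\<close>

text \<open>Testing against the set where \<open>k\<close> is negative shows that this set is null.\<close>

lemma AE_nonneg_if_set_integrals_nonneg:
  fixes k :: "'a \<Rightarrow> real"
  assumes k: "integrable M k"
    and nn: "\<And>A. A \<in> sets M \<Longrightarrow> 0 \<le> (\<integral>x. indicator A x * k x \<partial>M)"
  shows "AE x in M. 0 \<le> k x"
proof -
  define A where "A = {x \<in> space M. k x < 0}"
  have A: "A \<in> sets M" unfolding A_def using k by measurable
  have i: "integrable M (\<lambda>x. indicator A x * k x)"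
    using integrable_mult_indicator[OF A k] by simp
  have "(\<integral>x. - (indicator A x * k x) \<partial>M) \<le> 0"
    using nn[OF A] by simp
  moreover have np: "\<And>x. x \<in> space M \<Longrightarrow> 0 \<le> - (indicator A x * k x)"
    by (auto simp: A_def indicator_def)
  ultimately have "(\<integral>x. - (indicator A x * k x) \<partial>M) = 0"
    by (intro antisym integral_nonneg_AE AE_I2) auto
  then have "AE x in M. - (indicator A x * k x) = 0"
    using integral_nonneg_eq_0_iff_AE[of M "\<lambda>x. - (indicator A x * k x)"] i np by simp
  with AE_space show ?thesis
    by eventually_elim (auto simp: A_def indicator_def split: if_splits)
qed

text \<open>The duality between \<open>L\<^sup>1\<close> and \<open>L\<^sup>\<infinity>\<close>. The set function sending \<open>A\<close> to
  \<open>L (indicator A)\<close> is signed; adding \<open>C\<close> times the measure makes it nonnegative, and the bound on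
  \<open>L\<close> makes the sum countably additive and absolutely continuous. Its Radon-Nikodym density,
  shifted back by \<open>C\<close>, represents \<open>L\<close> on indicators, hence on simple functions, and the bound
  carries the representation to limits.\<close>

lemma finite_measure_L1_functional_density:
  fixes L :: "('a \<Rightarrow> real) \<Rightarrow> real"
  assumes fin: "finite_measure M"
    and add: "\<And>\<phi> \<psi>. integrable M \<phi> \<Longrightarrow> integrable M \<psi> \<Longrightarrow> L (\<lambda>x. \<phi> x + \<psi> x) = L \<phi> + L \<psi>"
    and scale: "\<And>c \<phi>. integrable M \<phi> \<Longrightarrow> L (\<lambda>x. c * \<phi> x) = c * L \<phi>"
    and bound: "\<And>\<phi>. integrable M \<phi> \<Longrightarrow> \<bar>L \<phi>\<bar> \<le> C * (\<integral>x. \<bar>\<phi> x\<bar> \<partial>M)"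
    and C: "0 \<le> C"
  shows "\<exists>h\<in>borel_measurable M. (\<forall>x. \<bar>h x\<bar> \<le> C) \<and>
           (\<forall>\<phi>. integrable M \<phi> \<longrightarrow> L \<phi> = (\<integral>x. \<phi> x * h x \<partial>M))"
proof -
  interpret finite_measure M by (rule fin)
  have ind [simp]: "A \<in> sets M \<Longrightarrow> integrable M (indicator A :: 'a \<Rightarrow> real)" for A
    by (simp add: less_top[symmetric])
  have bi: "\<bar>L (indicator A)\<bar> \<le> C * measure M A" if "A \<in> sets M" for A
    using bound[OF ind[OF that]] that by simp
  define \<nu> where "\<nu> A = ennreal (C * measure M A + L (indicator A))" for A
  have \<nu>_le: "\<nu> A \<le> ennreal (2 * C * measure M A)" if "A \<in> sets M" for A
    using bi[OF that] unfolding \<nu>_def by (intro ennreal_leI) auto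
  have pos: "positive (sets M) \<nu>"
    using bi[of "{}"] by (simp add: positive_def \<nu>_def)
  have addi: "additive (sets M) \<nu>"
  proof (unfold additive_def, intro ballI impI)
    fix A B assume AB: "A \<in> sets M" "B \<in> sets M" "A \<inter> B = {}"
    have e: "indicator (A \<union> B) = (\<lambda>x. indicator A x + indicator B x :: real)"
      using AB(3) by (auto simp: indicator_def fun_eq_iff)
    have "L (indicator (A \<union> B)) = L (indicator A) + L (indicator B)"
      unfolding e using AB by (intro add) auto
    moreover have "measure M (A \<union> B) = measure M A + measure M B"
      using AB by (intro finite_measure_Union) auto
    ultimately show "\<nu> (A \<union> B) = \<nu> A + \<nu> B"
      using bi[OF AB(1)] bi[OF AB(2)] unfolding \<nu>_def
      by (subst ennreal_plus[symmetric]) (auto simp: algebra_simps)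
  qed
  have ca: "countably_additive (sets M) \<nu>"
  proof (rule sets.empty_continuous_imp_countably_additive[OF pos addi])
    show "\<forall>A\<in>sets M. \<nu> A \<noteq> \<infinity>" by (simp add: \<nu>_def)
    fix A :: "nat \<Rightarrow> 'a set"
    assume A: "range A \<subseteq> sets M" "decseq A" "(\<Inter>i. A i) = {}"
    have "(\<lambda>i. measure M (A i)) \<longlonglongrightarrow> 0"
      using finite_Lim_measure_decseq[OF A(1,2)] A(3) by simp
    then have "(\<lambda>i. ennreal (2 * C * measure M (A i))) \<longlonglongrightarrow> ennreal (2 * C * 0)"
      by (intro tendsto_intros)
    then have lim: "(\<lambda>i. ennreal (2 * C * measure M (A i))) \<longlonglongrightarrow> 0" by simp
    have "\<nu> (A i) \<le> ennreal (2 * C * measure M (A i))" for i using A(1) by (intro \<nu>_le) auto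
    then show "(\<lambda>i. \<nu> (A i)) \<longlonglongrightarrow> 0"
      by (intro tendsto_sandwich[OF _ _ tendsto_const lim] always_eventually) auto
  qed
  define N where "N = measure_of (space M) (sets M) \<nu>"
  have [simp]: "sets N = sets M" "space N = space M" by (auto simp: N_def)
  have N: "emeasure N A = \<nu> A" if "A \<in> sets M" for A
    unfolding N_def by (rule emeasure_measure_of_sigma[OF sets.sigma_algebra_axioms pos ca that])
  have ac: "absolutely_continuous M N"
  proof (unfold absolutely_continuous_def, rule subsetI)
    fix A assume "A \<in> null_sets M"
    then show "A \<in> null_sets N"
      using \<nu>_le[of A] N[of A] by (auto simp: null_sets_def measure_def)
  qed
  obtain k where k: "k \<in> borel_measurable M" "density M k = N"
    using Radon_Nikodym[OF ac] by auto
  have kA: "(\<integral>\<^sup>+x. k x * indicator A x \<partial>M) = \<nu> A" if "A \<in> sets M" for A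
    using N[OF that] k that by (auto simp: emeasure_density)
  have "(\<integral>\<^sup>+x. k x \<partial>M) \<noteq> \<infinity>"
  proof -
    have "(\<integral>\<^sup>+x. k x \<partial>M) = (\<integral>\<^sup>+x. k x * indicator (space M) x \<partial>M)"
      by (intro nn_integral_cong) auto
    then show ?thesis using kA[of "space M"] by (simp add: \<nu>_def)
  qed
  then have kfin: "AE x in M. k x \<noteq> \<infinity>" using k(1) by (intro nn_integral_PInf_AE)
  define r where "r x = enn2real (k x)" for x
  have r [measurable]: "r \<in> borel_measurable M" using k(1) unfolding r_def by measurable
  have rA: "has_bochner_integral M (\<lambda>x. indicator A x * r x) (C * measure M A + L (indicator A))"
    if "A \<in> sets M" for A
  proof (rule has_bochner_integral_nn_integral)
    show "(\<lambda>x. indicator A x * r x) \<in> borel_measurable M" using that by measurable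
    show "AE x in M. 0 \<le> indicator A x * r x" by (auto simp: r_def)
    show "0 \<le> C * measure M A + L (indicator A)" using bi[OF that] by auto
    have "(\<integral>\<^sup>+x. ennreal (indicator A x * r x) \<partial>M) = (\<integral>\<^sup>+x. k x * indicator A x \<partial>M)"
      using kfin by (intro nn_integral_cong_AE, eventually_elim)
        (auto simp: r_def indicator_def less_top)
    then show "(\<integral>\<^sup>+x. ennreal (indicator A x * r x) \<partial>M) = ennreal (C * measure M A + L (indicator A))"
      using kA[OF that] by (simp add: \<nu>_def)
  qed
  define h0 where "h0 x = r x - C" for x
  have h0A: "has_bochner_integral M (\<lambda>x. indicator A x * h0 x) (L (indicator A))"
    if "A \<in> sets M" for A
  proof -
    have "has_bochner_integral M (\<lambda>x. C * indicator A x :: real) (C * measure M A)"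
      using that by (intro has_bochner_integral_mult_right has_bochner_integral_real_indicator)
        (auto simp: less_top[symmetric])
    from has_bochner_integral_diff[OF rA[OF that] this] show ?thesis
      by (simp add: h0_def algebra_simps)
  qed
  have ih0: "integrable M h0"
  proof -
    have "integrable M (\<lambda>x. indicator (space M) x * h0 x)"
      using h0A[of "space M"] by (auto simp: has_bochner_integral_iff)
    also have "?this \<longleftrightarrow> ?thesis" by (intro Bochner_Integration.integrable_cong) auto
    finally show ?thesis .
  qed
  have iA: "integrable M (\<lambda>x. indicator A x * h0 x)" "(\<integral>x. indicator A x * h0 x \<partial>M) = L (indicator A)"
    if "A \<in> sets M" for A
    using h0A[OF that] by (auto simp: has_bochner_integral_iff)
  have "AE x in M. 0 \<le> C - h0 x"
  proof (rule AE_nonneg_if_set_integrals_nonneg)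
    show "integrable M (\<lambda>x. C - h0 x)" using ih0 by auto
    fix A assume A: "A \<in> sets M"
    have "(\<integral>x. indicator A x * (C - h0 x) \<partial>M) = (\<integral>x. C * indicator A x - indicator A x * h0 x \<partial>M)"
      by (simp add: algebra_simps)
    also have "\<dots> = C * measure M A - L (indicator A)"
      using A iA[OF A] by (subst Bochner_Integration.integral_diff) auto
    finally show "0 \<le> (\<integral>x. indicator A x * (C - h0 x) \<partial>M)" using bi[OF A] by auto
  qed
  moreover have "AE x in M. 0 \<le> C + h0 x"
  proof (rule AE_nonneg_if_set_integrals_nonneg)
    show "integrable M (\<lambda>x. C + h0 x)" using ih0 by auto
    fix A assume A: "A \<in> sets M"
    have "(\<integral>x. indicator A x * (C + h0 x) \<partial>M) = (\<integral>x. C * indicator A x + indicator A x * h0 x \<partial>M)"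
      by (simp add: algebra_simps)
    also have "\<dots> = C * measure M A + L (indicator A)"
      using A iA[OF A] by (subst Bochner_Integration.integral_add) auto
    finally show "0 \<le> (\<integral>x. indicator A x * (C + h0 x) \<partial>M)" using bi[OF A] by auto
  qed
  ultimately have h0b: "AE x in M. \<bar>h0 x\<bar> \<le> C" by eventually_elim auto
  \<comment> \<open>Truncation makes the bound hold at every point.\<close>
  define h where "h x = max (- C) (min C (h0 x))" for x
  have hm [measurable]: "h \<in> borel_measurable M" unfolding h_def h0_def by measurable
  have hb: "\<bar>h x\<bar> \<le> C" for x using C by (auto simp: h_def)
  have hh0: "AE x in M. h x = h0 x" using h0b by eventually_elim (auto simp: h_def)
  have hb': "\<bar>y * h x\<bar> \<le> C * \<bar>y\<bar>" for x y
    using mult_right_mono[OF hb[of x], of "\<bar>y\<bar>"] by (simp add: abs_mult mult.commute)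
  have ih: "integrable M (\<lambda>x. \<phi> x * h x)" if "integrable M \<phi>" for \<phi>
    by (rule Bochner_Integration.integrable_bound[where f = "\<lambda>x. C * \<phi> x"])
       (use that hb' C in \<open>auto simp: abs_mult[of C]\<close>)
  have L_eq: "L \<phi> = (\<integral>x. \<phi> x * h x \<partial>M)" if "integrable M \<phi>" for \<phi>
    using that
  proof (induction rule: integrable_induct)
    case (base A c)
    have e: "L (\<lambda>x. indicator A x *\<^sub>R c) = c * L (indicator A)"
      using scale[OF ind[OF base(1)], of c] by (simp add: mult.commute)
    have "(\<integral>x. indicator A x * h x \<partial>M) = (\<integral>x. indicator A x * h0 x \<partial>M)"
      using hh0 base(1) by (intro integral_cong_AE) (auto simp: h0_def)
    then have "L (indicator A) = (\<integral>x. indicator A x * h x \<partial>M)" using iA[OF base(1)] by simp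
    with e show ?case by (simp add: mult_ac)
  next
    case (add \<phi> \<psi>)
    then show ?case using ih[OF add(1)] ih[OF add(2)] assms(2)[OF add(1,2)]
      by (simp add: algebra_simps)
  next
    case (lim \<phi> s)
    have d: "integrable M (\<lambda>x. s i x - \<phi> x)" for i using lim(1,4) by auto
    have to0: "(\<lambda>i. \<integral>x. \<bar>s i x - \<phi> x\<bar> \<partial>M) \<longlonglongrightarrow> (\<integral>x. 0 \<partial>M)"
    proof (rule integral_dominated_convergence[where w = "\<lambda>x. 3 * \<bar>\<phi> x\<bar>"])
      show "AE x in M. (\<lambda>i. \<bar>s i x - \<phi> x\<bar>) \<longlonglongrightarrow> 0"
        using lim(2) by (intro AE_I2 tendsto_rabs_zero) (simp add: LIM_zero_iff)
      show "AE x in M. norm \<bar>s i x - \<phi> x\<bar> \<le> 3 * \<bar>\<phi> x\<bar>" for i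
        using lim(3)[of _ i] by (intro AE_I2) (smt (verit) real_norm_def)
    qed (use lim d in auto)
    have Ld: "L (s i) - L \<phi> = L (\<lambda>x. s i x - \<phi> x)" for i
      using assms(2)[OF d[of i] lim(4)] by simp
    have hd: "(\<integral>x. s i x * h x \<partial>M) - (\<integral>x. \<phi> x * h x \<partial>M) = (\<integral>x. (s i x - \<phi> x) * h x \<partial>M)" for i
      using ih[OF lim(1)[of i]] ih[OF lim(4)] by (simp add: algebra_simps)
    have "\<bar>L \<phi> - (\<integral>x. \<phi> x * h x \<partial>M)\<bar> \<le> 2 * C * (\<integral>x. \<bar>s i x - \<phi> x\<bar> \<partial>M)" for i
    proof -
      have "\<bar>\<integral>x. (s i x - \<phi> x) * h x \<partial>M\<bar> \<le> (\<integral>x. \<bar>(s i x - \<phi> x) * h x\<bar> \<partial>M)"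
        by (rule integral_abs_bound)
      also have "\<dots> \<le> (\<integral>x. C * \<bar>s i x - \<phi> x\<bar> \<partial>M)"
        using ih[OF d[of i]] d[of i] hb'
        by (intro integral_mono) auto
      finally show ?thesis using bound[OF d[of i]] Ld[of i] hd[of i] lim(5)[of i] by simp
    qed
    moreover have "(\<lambda>i. 2 * C * (\<integral>x. \<bar>s i x - \<phi> x\<bar> \<partial>M)) \<longlonglongrightarrow> 2 * C * 0"
      using to0 by (intro tendsto_intros) auto
    ultimately have "\<bar>L \<phi> - (\<integral>x. \<phi> x * h x \<partial>M)\<bar> \<le> 0"
      by (intro LIMSEQ_le_const[where X = "\<lambda>i. 2 * C * (\<integral>x. \<bar>s i x - \<phi> x\<bar> \<partial>M)"]) auto
    then show ?case by simp
  qed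
  from hm hb L_eq show ?thesis by blast
qed


text \<open>The same duality for the measure with density \<open>g\<close>, which need only be \<open>\<sigma>\<close>-finite. The
  functional is kept as a function on representatives: for the derivative it is given explicitly on
  all of weighted \<open>L\<^sup>1\<close>, so that no extension from test functions is ever made.\<close>

lemma weighted_L1_functional_density:
  fixes L :: "('a \<Rightarrow> real) \<Rightarrow> real" and g :: "'a \<Rightarrow> real"
  assumes sf: "sigma_finite_measure M"
    and g [measurable]: "g \<in> borel_measurable M" and g0: "\<And>x. 0 \<le> g x"
    and add: "\<And>\<phi> \<psi>. \<phi> \<in> borel_measurable M \<Longrightarrow> integrable M (\<lambda>x. \<phi> x * g x) \<Longrightarrow>
      \<psi> \<in> borel_measurable M \<Longrightarrow> integrable M (\<lambda>x. \<psi> x * g x) \<Longrightarrow>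
      L (\<lambda>x. \<phi> x + \<psi> x) = L \<phi> + L \<psi>"
    and scale: "\<And>c \<phi>. \<phi> \<in> borel_measurable M \<Longrightarrow> integrable M (\<lambda>x. \<phi> x * g x) \<Longrightarrow>
      L (\<lambda>x. c * \<phi> x) = c * L \<phi>"
    and bound: "\<And>\<phi>. \<phi> \<in> borel_measurable M \<Longrightarrow> integrable M (\<lambda>x. \<phi> x * g x) \<Longrightarrow>
      \<bar>L \<phi>\<bar> \<le> C * (\<integral>x. \<bar>\<phi> x\<bar> * g x \<partial>M)"
    and C: "0 \<le> C"
  shows "\<exists>h\<in>borel_measurable M. (\<forall>x. \<bar>h x\<bar> \<le> C * g x) \<and>
    (\<forall>\<phi>. \<phi> \<in> borel_measurable M \<and> integrable M (\<lambda>x. \<phi> x * g x) \<longrightarrow> L \<phi> = (\<integral>x. \<phi> x * h x \<partial>M))"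
proof -
  obtain u :: "'a \<Rightarrow> real" where u: "u \<in> borel_measurable M" "\<And>x. u x > 0" "integrable M u"
    using sigma_finite_measure.obtain_positive_integrable_function[OF sf] by blast
  \<comment> \<open>This choice keeps \<open>w\<close> positive while \<open>w * g\<close> is dominated by the integrable \<open>u\<close>, so that the density \<open>w * g\<close> gives a finite measure.\<close>
  define w where "w x = u x / (1 + g x)" for x
  have w [measurable]: "w \<in> borel_measurable M" using u(1) unfolding w_def by measurable
  have wpos: "0 < w x" for x using u(2)[of x] g0[of x] by (simp add: w_def add_pos_nonneg)
  have wgu: "w x * g x \<le> u x" for x
  proof -
    have "u x * g x \<le> u x * (1 + g x)" using u(2)[of x] by (intro mult_left_mono) auto
    then show ?thesis using g0[of x] by (simp add: w_def divide_le_eq add_pos_nonneg)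
  qed
  have wg0: "0 \<le> w x * g x" for x using wpos[of x] g0[of x] by simp
  have iwg: "integrable M (\<lambda>x. w x * g x)"
    by (rule Bochner_Integration.integrable_bound[OF u(3)]) (use wgu wg0 in \<open>auto intro!: AE_I2 simp: order_trans[OF wgu abs_ge_self]\<close>)
  define M' where "M' = density M (\<lambda>x. ennreal (w x * g x))"
  have fin: "finite_measure M'"
  proof (rule finite_measureI)
    have "emeasure M' (space M') = (\<integral>\<^sup>+x. ennreal (w x * g x) \<partial>M)"
      by (simp add: M'_def emeasure_density cong: nn_integral_cong)
    also have "\<dots> = ennreal (\<integral>x. w x * g x \<partial>M)"
      by (intro nn_integral_eq_integral iwg AE_I2 wg0)
    finally show "emeasure M' (space M') \<noteq> \<infinity>" by simp
  qed
  have dens: "integrable M' \<phi> \<longleftrightarrow> integrable M (\<lambda>x. w x * \<phi> x * g x)"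
    "(\<integral>x. \<phi> x \<partial>M') = (\<integral>x. w x * \<phi> x * g x \<partial>M)"
    if m: "\<phi> \<in> borel_measurable M" for \<phi>
  proof -
    have e: "(w x * g x) *\<^sub>R \<phi> x = w x * \<phi> x * g x" for x by simp
    have wgm: "(\<lambda>x. w x * g x) \<in> borel_measurable M" by measurable
    show "integrable M' \<phi> \<longleftrightarrow> integrable M (\<lambda>x. w x * \<phi> x * g x)"
      using integrable_density[OF m wgm AE_I2[OF wg0]] unfolding M'_def e .
    show "(\<integral>x. \<phi> x \<partial>M') = (\<integral>x. w x * \<phi> x * g x \<partial>M)"
      using integral_density[OF m wgm AE_I2[OF wg0]] unfolding M'_def e .
  qed
  have iM': "\<phi> \<in> borel_measurable M" "(\<lambda>x. w x * \<phi> x) \<in> borel_measurable M"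
    "integrable M (\<lambda>x. w x * \<phi> x * g x)" if "integrable M' \<phi>" for \<phi>
  proof -
    show m [measurable]: "\<phi> \<in> borel_measurable M"
      using borel_measurable_integrable[OF that] by (simp add: M'_def)
    show "(\<lambda>x. w x * \<phi> x) \<in> borel_measurable M" by measurable
    show "integrable M (\<lambda>x. w x * \<phi> x * g x)" using that dens(1)[OF m] by simp
  qed
  obtain h where h: "h \<in> borel_measurable M'" "\<And>x. \<bar>h x\<bar> \<le> C"
    "\<And>\<phi>. integrable M' \<phi> \<Longrightarrow> L (\<lambda>x. w x * \<phi> x) = (\<integral>x. \<phi> x * h x \<partial>M')"
  proof -
    have "\<exists>h\<in>borel_measurable M'. (\<forall>x. \<bar>h x\<bar> \<le> C) \<and>
       (\<forall>\<phi>. integrable M' \<phi> \<longrightarrow> L (\<lambda>x. w x * \<phi> x) = (\<integral>x. \<phi> x * h x \<partial>M'))"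
    proof (rule finite_measure_L1_functional_density[OF fin _ _ _ C])
      fix \<phi> \<psi> :: "'a \<Rightarrow> real" assume i: "integrable M' \<phi>" "integrable M' \<psi>"
      show "L (\<lambda>x. w x * (\<phi> x + \<psi> x)) = L (\<lambda>x. w x * \<phi> x) + L (\<lambda>x. w x * \<psi> x)"
        unfolding distrib_left by (rule add[OF iM'(2,3)[OF i(1)] iM'(2,3)[OF i(2)]])
    next
      fix c and \<phi> :: "'a \<Rightarrow> real" assume i: "integrable M' \<phi>"
      show "L (\<lambda>x. w x * (c * \<phi> x)) = c * L (\<lambda>x. w x * \<phi> x)"
        unfolding mult.left_commute[of _ c] by (rule scale[OF iM'(2,3)[OF i]])
    next
      fix \<phi> :: "'a \<Rightarrow> real" assume i: "integrable M' \<phi>"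
      have "\<bar>w x * \<phi> x\<bar> = w x * \<bar>\<phi> x\<bar>" for x using wpos[of x] by (simp add: abs_mult)
      then show "\<bar>L (\<lambda>x. w x * \<phi> x)\<bar> \<le> C * (\<integral>x. \<bar>\<phi> x\<bar> \<partial>M')"
        using bound[OF iM'(2,3)[OF i]] dens(2)[OF borel_measurable_abs[OF iM'(1)[OF i]]] by simp
    qed
    with that show thesis by blast
  qed
  have [measurable]: "h \<in> borel_measurable M" using h(1) by (simp add: M'_def)
  have "L \<phi> = (\<integral>x. \<phi> x * (h x * g x) \<partial>M)"
    if [measurable]: "\<phi> \<in> borel_measurable M" and "integrable M (\<lambda>x. \<phi> x * g x)" for \<phi>
  proof -
    have w0: "w x \<noteq> 0" for x using wpos[of x] by simp
    have m: "(\<lambda>x. \<phi> x / w x) \<in> borel_measurable M" "(\<lambda>x. \<phi> x / w x * h x) \<in> borel_measurable M"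
      by measurable
    have i: "integrable M' (\<lambda>x. \<phi> x / w x)"
      using dens(1)[OF m(1)] that(2) w0 by simp
    have "L \<phi> = L (\<lambda>x. w x * (\<phi> x / w x))" using w0 by simp
    also have "\<dots> = (\<integral>x. \<phi> x / w x * h x \<partial>M')" by (rule h(3)[OF i])
    also have "\<dots> = (\<integral>x. w x * (\<phi> x / w x * h x) * g x \<partial>M)" by (rule dens(2)[OF m(2)])
    also have "\<dots> = (\<integral>x. \<phi> x * (h x * g x) \<partial>M)"
      using w0 by (intro Bochner_Integration.integral_cong) auto
    finally show ?thesis .
  qed
  moreover have "\<bar>h x * g x\<bar> \<le> C * g x" for x
    using h(2)[of x] g0[of x] by (simp add: abs_mult mult_right_mono)
  ultimately show ?thesis by (intro bexI[of _ "\<lambda>x. h x * g x"]) auto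
qed

section \<open>Smooth bump functions\<close>

lemma partial_deriv_eqI: "(f has_derivative f') (at x) \<Longrightarrow> partial_deriv j f x = f' (axis j 1)"
  by (simp add: partial_deriv_def frechet_derivative_at[symmetric])

lemma k_times_cont_diff_continuous: "k_times_cont_diff k f \<Longrightarrow> continuous_on UNIV f"
  by (cases k) (auto intro!: continuous_at_imp_continuous_on differentiable_imp_continuous_within)

lemma k_times_cont_diff_Suc_D: "k_times_cont_diff (Suc k) f \<Longrightarrow> k_times_cont_diff k f"
proof (induction k arbitrary: f)
  case 0
  then show ?case using k_times_cont_diff_continuous[of "Suc 0" f] by simp
next
  case (Suc k)
  then show ?case by (metis k_times_cont_diff.simps(2))
qed

lemma k_times_cont_diff_const [simp]: "k_times_cont_diff k (\<lambda>x. c)"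
proof (induction k arbitrary: c)
  case (Suc k)
  have "partial_deriv j (\<lambda>x. c) = (\<lambda>x. 0)" for j :: 'a
    by (rule ext, subst partial_deriv_eqI[OF has_derivative_const]) simp
  with Suc show ?case by simp
qed simp

lemma k_times_cont_diff_coord [simp]: "k_times_cont_diff k (\<lambda>x. x $ i)"
proof (cases k)
  case (Suc m)
  have d: "((\<lambda>x. x $ i) has_derivative (\<lambda>x. x $ i)) (at x)" for x :: "real^'a"
    by (rule bounded_linear_imp_has_derivative) (rule bounded_linear_vec_nth)
  have "partial_deriv j (\<lambda>x. x $ i) = (\<lambda>x. axis j 1 $ i)" for j :: 'a
    by (rule ext, subst partial_deriv_eqI[OF d]) simp
  with Suc d show ?thesis by (auto simp: differentiable_def)
qed (simp add: continuous_on_component)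

lemma k_times_cont_diff_add:
  "k_times_cont_diff k f \<Longrightarrow> k_times_cont_diff k g \<Longrightarrow> k_times_cont_diff k (\<lambda>x. f x + g x)"
proof (induction k arbitrary: f g)
  case 0
  then show ?case by (auto intro: continuous_on_add)
next
  case (Suc k)
  have d: "f differentiable (at x)" "g differentiable (at x)" for x using Suc.prems by auto
  have "partial_deriv j (\<lambda>x. f x + g x) = (\<lambda>x. partial_deriv j f x + partial_deriv j g x)" for j
    by (rule ext, subst partial_deriv_eqI[OF has_derivative_add[OF
       d(1)[unfolded frechet_derivative_works] d(2)[unfolded frechet_derivative_works]]])
      (simp add: partial_deriv_def)
  with Suc d show ?case by auto
qed

lemma k_times_cont_diff_mult:
  "k_times_cont_diff k f \<Longrightarrow> k_times_cont_diff k g \<Longrightarrow> k_times_cont_diff k (\<lambda>x. f x * g x)"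
proof (induction k arbitrary: f g)
  case 0
  then show ?case by (auto intro: continuous_on_mult)
next
  case (Suc k)
  have d: "f differentiable (at x)" "g differentiable (at x)" for x using Suc.prems by auto
  have "partial_deriv j (\<lambda>x. f x * g x) =
      (\<lambda>x. f x * partial_deriv j g x + partial_deriv j f x * g x)" for j
    by (rule ext, subst partial_deriv_eqI[OF has_derivative_mult[OF
       d(1)[unfolded frechet_derivative_works] d(2)[unfolded frechet_derivative_works]]])
      (simp add: partial_deriv_def)
  moreover have "k_times_cont_diff k f" "k_times_cont_diff k g"
    using Suc.prems by (auto intro!: k_times_cont_diff_Suc_D simp del: k_times_cont_diff.simps)
  ultimately show ?case using Suc d by (auto intro!: k_times_cont_diff_add)
qed

lemma k_times_cont_diff_prod:
  "(\<And>i. i \<in> I \<Longrightarrow> k_times_cont_diff k (f i)) \<Longrightarrow> k_times_cont_diff k (\<lambda>x. \<Prod>i\<in>I. f i x)"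
  by (induction I rule: infinite_finite_induct) (auto intro!: k_times_cont_diff_mult)

text \<open>The function \<open>flat_exp 0\<close> is the standard smooth function vanishing to infinite order at \<open>0\<close>; the
  powers of the reciprocal are those that its derivatives produce.\<close>

definition flat_exp :: "nat \<Rightarrow> real \<Rightarrow> real" where
  "flat_exp m t = (if t \<le> 0 then 0 else exp (- inverse t) * inverse t ^ m)"

text \<open>Substituting the reciprocal of \<open>t\<close> turns this into the decay of a power divided by the exponential.\<close>

lemma flat_exp_tendsto_0: "(flat_exp m \<longlongrightarrow> 0) (at 0)"
proof (rule filterlim_split_at)
  show "(flat_exp m \<longlongrightarrow> 0) (at_left 0)"
    by (rule tendsto_eventually) (auto simp: flat_exp_def eventually_at_filter)
  have "((\<lambda>t. inverse t ^ m / exp (inverse t)) \<longlongrightarrow> 0) (at_right (0::real))"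
    using tendsto_power_div_exp_0 filterlim_inverse_at_top_right by (rule filterlim_compose)
  then show "(flat_exp m \<longlongrightarrow> 0) (at_right 0)"
    by (rule Lim_transform_eventually)
      (auto simp: flat_exp_def eventually_at_filter exp_minus divide_inverse mult.commute)
qed

lemma flat_exp_has_derivative:
  "(flat_exp m has_real_derivative flat_exp (m + 2) t - m * flat_exp (m + 1) t) (at t)"
proof -
  consider "t < 0" | "t = 0" | "0 < t" by linarith
  then show ?thesis
  proof cases
    case 1
    then have "eventually (\<lambda>y. flat_exp m y = 0) (nhds t)"
      by (intro eventually_mono[OF eventually_nhds_in_open[of "{..<0}" t]]) (auto simp: flat_exp_def)
    then have "(flat_exp m has_real_derivative 0) (at t) \<longleftrightarrow> ((\<lambda>_. 0) has_real_derivative 0) (at t)"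
      by (intro DERIV_cong_ev) auto
    with 1 show ?thesis by (simp add: flat_exp_def)
  next
    case 2
    have "((\<lambda>y. (flat_exp m y - flat_exp m 0) / (y - 0)) \<longlongrightarrow> 0) (at 0)"
      by (rule Lim_transform_eventually[OF flat_exp_tendsto_0[of "Suc m"]])
        (auto simp: flat_exp_def eventually_at_filter divide_inverse)
    then show ?thesis using 2 unfolding has_field_derivative_iff by (simp add: flat_exp_def)
  next
    case 3
    then have e: "eventually (\<lambda>y. flat_exp m y = exp (- inverse y) * inverse y ^ m) (nhds t)"
      by (intro eventually_mono[OF eventually_nhds_in_open[of "{0<..}" t]]) (auto simp: flat_exp_def)
    have "((\<lambda>y. exp (- inverse y) * inverse y ^ m) has_real_derivative flat_exp (m + 2) t - m * flat_exp (m + 1) t) (at t)"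
    proof (rule DERIV_cong)
      show "((\<lambda>y. exp (- inverse y) * inverse y ^ m) has_real_derivative
          exp (- inverse t) * (inverse t)\<^sup>2 * inverse t ^ m
            - exp (- inverse t) * (m * inverse t ^ (m - 1) * (inverse t)\<^sup>2)) (at t)"
        using 3 by (auto intro!: derivative_eq_intros simp: power2_eq_square algebra_simps)
      show "exp (- inverse t) * (inverse t)\<^sup>2 * inverse t ^ m
            - exp (- inverse t) * (m * inverse t ^ (m - 1) * (inverse t)\<^sup>2) =
          flat_exp (m + 2) t - m * flat_exp (m + 1) t"
        using 3 by (cases m) (auto simp: flat_exp_def power2_eq_square algebra_simps)
    qed
    moreover have "(flat_exp m has_real_derivative flat_exp (m + 2) t - m * flat_exp (m + 1) t) (at t)
      \<longleftrightarrow> ((\<lambda>y. exp (- inverse y) * inverse y ^ m) has_real_derivative flat_exp (m + 2) t - m * flat_exp (m + 1) t) (at t)"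
      by (rule DERIV_cong_ev[OF refl e refl])
    ultimately show ?thesis by simp
  qed
qed

text \<open>The functions \<open>flat_exp m\<close>, for all \<open>m\<close> together, are closed under differentiation up to
  linear combinations. This is why the induction must be for all \<open>m\<close> at once.\<close>

lemma k_times_cont_diff_flat_exp:
  assumes q: "\<And>k. k_times_cont_diff k q"
  shows "k_times_cont_diff k (\<lambda>x. flat_exp m (q x))"
proof -
  have "q differentiable (at x)" for x using q[of "Suc 0"] by simp
  note qd = this[unfolded frechet_derivative_works]
  have d: "((\<lambda>x. flat_exp m (q x)) has_derivative
     (\<lambda>y. (flat_exp (m + 2) (q x) - m * flat_exp (m + 1) (q x)) * frechet_derivative q (at x) y)) (at x)"
    for m :: nat and x
    using has_derivative_compose[OF qd[of x] flat_exp_has_derivative[of m "q x", unfolded has_field_derivative_def]]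
    by simp
  show ?thesis
  proof (induction k arbitrary: m)
    case 0
    have "continuous_on UNIV (\<lambda>x. flat_exp m (q x))"
      by (intro continuous_at_imp_continuous_on ballI has_derivative_continuous[OF d])
    then show ?case by simp
  next
    case (Suc k)
    have "partial_deriv j (\<lambda>x. flat_exp m (q x)) =
      (\<lambda>x. (flat_exp (m + 2) (q x) + (- real m) * flat_exp (m + 1) (q x)) * partial_deriv j q x)" for j
      by (rule ext, subst partial_deriv_eqI[OF d]) (simp add: partial_deriv_def)
    moreover have "k_times_cont_diff k
        (\<lambda>x. flat_exp (m + 2) (q x) + (- real m) * flat_exp (m + 1) (q x))"
      by (intro k_times_cont_diff_add k_times_cont_diff_mult k_times_cont_diff_const Suc)
    moreover have "k_times_cont_diff k (partial_deriv j q)" for j using q[of "Suc k"] by simp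
    moreover have "(\<lambda>x. flat_exp m (q x)) differentiable (at x)" for x
      using d unfolding differentiable_def by blast
    ultimately show ?case
      by (auto intro!: k_times_cont_diff_mult)
  qed
qed

definition box_bump :: "real \<Rightarrow> real^'n::finite \<Rightarrow> real^'n \<Rightarrow> real^'n \<Rightarrow> real" where
  "box_bump s a b x = (\<Prod>i\<in>UNIV. flat_exp 0 (s * (x $ i - a $ i)) * flat_exp 0 (s * (b $ i - x $ i)))"

lemma box_bump_smooth: "smooth_fun (box_bump s a b)"
proof -
  have 1: "k_times_cont_diff k (\<lambda>x. s * (x $ i - a $ i))" for k i
    using k_times_cont_diff_add[OF k_times_cont_diff_mult[OF k_times_cont_diff_const[of k s] k_times_cont_diff_coord[of k i]]
        k_times_cont_diff_const[of k "- s * a $ i"]]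
    by (simp add: algebra_simps)
  have 2: "k_times_cont_diff k (\<lambda>x. s * (b $ i - x $ i))" for k i
    using k_times_cont_diff_add[OF k_times_cont_diff_mult[OF k_times_cont_diff_const[of k "-s"] k_times_cont_diff_coord[of k i]]
        k_times_cont_diff_const[of k "s * b $ i"]]
    by (simp add: algebra_simps)
  show ?thesis
    unfolding smooth_fun_def box_bump_def[abs_def]
    by (intro allI k_times_cont_diff_prod k_times_cont_diff_mult k_times_cont_diff_flat_exp 1 2)
qed

lemma box_bump_nonzero_iff: "0 < s \<Longrightarrow> box_bump s a b x \<noteq> 0 \<longleftrightarrow> x \<in> box a b"
  by (auto simp: box_bump_def flat_exp_def mem_box_cart zero_less_mult_iff mult_le_0_iff not_le)

lemma box_bump_bounds: "0 \<le> box_bump s a b x" "box_bump s a b x \<le> 1"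
proof -
  have f: "0 \<le> flat_exp 0 t \<and> flat_exp 0 t \<le> 1" for t by (auto simp: flat_exp_def)
  show "0 \<le> box_bump s a b x" unfolding box_bump_def using f by (intro prod_nonneg) auto
  show "box_bump s a b x \<le> 1" unfolding box_bump_def using f
    by (intro prod_le_1) (auto intro!: mult_le_one)
qed

text \<open>As \<open>exp (- 1 / (n t))\<close> tends to \<open>1\<close> for \<open>t > 0\<close>, dilating the argument is enough to recover the
  indicator.\<close>

lemma box_bump_tendsto_indicator:
  "(\<lambda>n. box_bump (real (Suc n)) a b x) \<longlonglongrightarrow> indicator (box a b) x"
proof (cases "x \<in> box a b")
  case True
  have f: "(\<lambda>n. flat_exp 0 (real (Suc n) * t)) \<longlonglongrightarrow> 1" if "0 < t" for t
  proof -
    have "(\<lambda>n. - (inverse (real (Suc n)) * inverse t)) \<longlonglongrightarrow> - (0 * inverse t)"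
      by (intro tendsto_intros LIMSEQ_inverse_real_of_nat)
    then have "(\<lambda>n. exp (- (inverse (real (Suc n)) * inverse t))) \<longlonglongrightarrow> exp (- (0 * inverse t))"
      by (rule tendsto_exp)
    moreover have "flat_exp 0 (real (Suc n) * t) = exp (- (inverse (real (Suc n)) * inverse t))" for n
      using mult_pos_pos[OF of_nat_0_less_iff[THEN iffD2, OF zero_less_Suc[of n]] that]
      by (simp add: flat_exp_def del: of_nat_Suc)
    ultimately show ?thesis by simp
  qed
  have "(\<lambda>n. box_bump (real (Suc n)) a b x) \<longlonglongrightarrow> (\<Prod>i\<in>(UNIV::'a set). 1 * 1)"
    unfolding box_bump_def using True by (intro tendsto_prod tendsto_mult f) (auto simp: mem_box_cart)
  with True show ?thesis by simp
next
  case False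
  then have "box_bump (real (Suc n)) a b x = 0" for n
    using box_bump_nonzero_iff[of "real (Suc n)" a b x] by auto
  with False show ?thesis by simp
qed

lemma box_bump_test_function:
  assumes "cbox a b \<subseteq> \<Omega>" "0 < s"
  shows "box_bump s a b \<in> test_functions \<Omega>"
proof -
  have "closure {x. box_bump s a b x \<noteq> 0} \<subseteq> cbox a b"
    using box_bump_nonzero_iff[OF assms(2), of a b] box_subset_cbox[of a b]
    by (intro closure_minimal) auto
  moreover from this have "compact (closure {x. box_bump s a b x \<noteq> 0})"
    using compact_cbox[of a b] by (meson closed_closure compact_eq_bounded_closed bounded_subset)
  ultimately show ?thesis using assms box_bump_smooth[of s a b] by (auto simp: test_functions_def)
qed

section \<open>The fundamental lemma of the calculus of variations\<close>

lemma integrable_lebesgue_on_iff: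
  fixes f :: "'a::euclidean_space \<Rightarrow> real"
  shows "S \<in> sets lebesgue \<Longrightarrow> integrable (lebesgue_on S) f \<longleftrightarrow> integrable lebesgue (\<lambda>x. indicator S x * f x)"
  by (subst integrable_restrict_space) simp_all

lemma integral_lebesgue_on_eq:
  fixes f :: "'a::euclidean_space \<Rightarrow> real"
  shows "S \<in> sets lebesgue \<Longrightarrow> (\<integral>x. f x \<partial>lebesgue_on S) = (\<integral>x. indicator S x * f x \<partial>lebesgue)"
  by (subst integral_restrict_space) simp_all

lemma continuous_imp_lebesgue_measurable:
  fixes \<psi> :: "'a::euclidean_space \<Rightarrow> real"
  assumes "continuous_on UNIV \<psi>"
  shows "\<psi> \<in> borel_measurable lebesgue"
  using measurable_completion[of \<psi> lborel borel] borel_measurable_continuous_onI[OF assms] by simp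

lemma compact_support_bounded:
  fixes \<psi> :: "'a::euclidean_space \<Rightarrow> real"
  assumes "continuous_on UNIV \<psi>" "compact K" "\<And>x. x \<notin> K \<Longrightarrow> \<psi> x = 0"
  obtains B where "0 \<le> B" "\<And>x. \<bar>\<psi> x\<bar> \<le> B"
proof -
  have "bounded (\<psi> ` K)"
    using assms by (intro compact_imp_bounded compact_continuous_image) (auto intro: continuous_on_subset)
  then obtain B where "\<And>x. x \<in> K \<Longrightarrow> \<bar>\<psi> x\<bar> \<le> B" by (auto simp: bounded_iff)
  then have "\<bar>\<psi> x\<bar> \<le> max 0 B" for x using assms(3)[of x] by (cases "x \<in> K") force+
  then show thesis by (intro that[of "max 0 B"]) auto
qed

lemma integrable_compact_support_mult:
  assumes \<Omega>: "open \<Omega>" and h: "locally_integrable \<Omega> h"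
    and \<psi>: "continuous_on UNIV \<psi>" "compact K" "K \<subseteq> \<Omega>" "\<And>x. x \<notin> K \<Longrightarrow> \<psi> x = 0"
  shows "integrable (lebesgue_on \<Omega>) (\<lambda>x. \<psi> x * h x)"
proof -
  obtain B where B: "0 \<le> B" "\<And>x. \<bar>\<psi> x\<bar> \<le> B" using compact_support_bounded[OF \<psi>(1,2,4)] by blast
  have K: "K \<in> sets lebesgue" using \<psi>(2) by (simp add: compact_imp_closed lmeasurable_compact fmeasurableD)
  have \<Omega>': "\<Omega> \<in> sets lebesgue" using \<Omega> by auto
  have i: "integrable lebesgue (\<lambda>x. indicator K x * h x)"
    using h \<psi>(2,3) K by (simp add: locally_integrable_def integrable_lebesgue_on_iff[symmetric])
  have "integrable lebesgue (\<lambda>x. \<psi> x * (indicator K x * h x))"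
  proof (rule Bochner_Integration.integrable_bound[OF integrable_mult_right[OF i, of B]])
    show "(\<lambda>x. \<psi> x * (indicator K x * h x)) \<in> borel_measurable lebesgue"
      by (intro borel_measurable_times continuous_imp_lebesgue_measurable \<psi>(1) borel_measurable_integrable[OF i])
    show "AE x in lebesgue. norm (\<psi> x * (indicator K x * h x)) \<le> norm (B * (indicator K x * h x))"
      using B by (intro AE_I2) (auto simp: abs_mult intro!: mult_right_mono)
  qed
  also have "(\<lambda>x. \<psi> x * (indicator K x * h x)) = (\<lambda>x. indicator \<Omega> x * (\<psi> x * h x))"
    using \<psi>(3,4) by (auto simp: fun_eq_iff indicator_def)
  finally show ?thesis using \<Omega>' by (simp add: integrable_lebesgue_on_iff)
qed

lemma test_function_support:
  assumes "\<phi> \<in> test_functions \<Omega>"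
  obtains K where "compact K" "K \<subseteq> \<Omega>" "continuous_on UNIV \<phi>" "\<And>x. x \<notin> K \<Longrightarrow> \<phi> x = 0"
    "\<And>j. continuous_on UNIV (partial_deriv j \<phi>)" "\<And>j x. x \<notin> K \<Longrightarrow> partial_deriv j \<phi> x = 0"
proof -
  define K where "K = closure {x. \<phi> x \<noteq> 0}"
  have s: "k_times_cont_diff (Suc 0) \<phi>" and K: "compact K" "K \<subseteq> \<Omega>"
    using assms by (auto simp: test_functions_def smooth_fun_def K_def simp del: k_times_cont_diff.simps)
  have z: "x \<notin> K \<Longrightarrow> \<phi> x = 0" for x using closure_subset[of "{x. \<phi> x \<noteq> 0}"] by (auto simp: K_def)
  have "partial_deriv j \<phi> x = 0" if "x \<notin> K" for j x
  proof -
    have "(\<phi> has_derivative (\<lambda>_. 0)) (at x)"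
      by (rule has_derivative_transform_within_open[OF has_derivative_const, of "- K"])
         (use that z K(1) in \<open>auto intro: compact_imp_closed simp: open_Compl\<close>)
    then show ?thesis by (simp add: partial_deriv_eqI)
  qed
  with K z s k_times_cont_diff_continuous[OF s] show thesis by (intro that[of K]) auto
qed

lemma test_function_integrable:
  assumes "open \<Omega>" "locally_integrable \<Omega> h" "\<phi> \<in> test_functions \<Omega>"
  shows "integrable (lebesgue_on \<Omega>) (\<lambda>x. \<phi> x * h x)"
    and "integrable (lebesgue_on \<Omega>) (\<lambda>x. partial_deriv j \<phi> x * h x)"
proof -
  obtain K where K: "compact K" "K \<subseteq> \<Omega>" "continuous_on UNIV \<phi>" "\<And>x. x \<notin> K \<Longrightarrow> \<phi> x = 0"
    "\<And>j. continuous_on UNIV (partial_deriv j \<phi>)" "\<And>j x. x \<notin> K \<Longrightarrow> partial_deriv j \<phi> x = 0"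
    using test_function_support[OF assms(3)] by metis
  show "integrable (lebesgue_on \<Omega>) (\<lambda>x. \<phi> x * h x)"
    by (rule integrable_compact_support_mult[OF assms(1,2) K(3,1,2,4)])
  show "integrable (lebesgue_on \<Omega>) (\<lambda>x. partial_deriv j \<phi> x * h x)"
    by (rule integrable_compact_support_mult[OF assms(1,2) K(5,1,2,6)])
qed

text \<open>Boxes are stable under intersection and generate the Borel sets, so the vanishing of the integrals
  spreads to all Borel sets by Dynkin's theorem, and then to all Lebesgue sets, which differ from Borel
  sets by null sets.\<close>

lemma AE_zero_if_box_integrals_zero:
  fixes k :: "real^'n::finite \<Rightarrow> real"
  assumes k: "integrable lebesgue k"
    and box: "\<And>a b. (\<integral>x. indicator (box a b) x * k x \<partial>lebesgue) = 0"
  shows "AE x in lebesgue. k x = 0"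
proof -
  have iA: "integrable lebesgue (\<lambda>x. indicator A x * k x)" if "A \<in> sets lebesgue" for A
    using integrable_mult_indicator[OF that k] by simp
  \<comment> \<open>The whole space is not a box; it is the limit of the boxes \<open>box (- b n) (b n)\<close>.\<close>
  have tot: "(\<integral>x. k x \<partial>lebesgue) = 0"
  proof -
    define b :: "nat \<Rightarrow> real^'n" where "b n = (\<chi> i. real n)" for n
    have "(\<lambda>n. \<integral>x. indicator (box (- b n) (b n)) x * k x \<partial>lebesgue) \<longlonglongrightarrow> (\<integral>x. k x \<partial>lebesgue)"
    proof (rule integral_dominated_convergence[where w = "\<lambda>x. \<bar>k x\<bar>"])
      show "AE x in lebesgue. (\<lambda>n. indicator (box (- b n) (b n)) x * k x) \<longlonglongrightarrow> k x"
      proof (intro AE_I2 tendsto_eventually)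
        fix x :: "real^'n"
        obtain N where N: "norm x < real N" using reals_Archimedean2 by blast
        have "x \<in> box (- b n) (b n)" if "N \<le> n" for n
        proof -
          have "\<bar>x $ i\<bar> < real n" for i using component_le_norm_cart[of x i] N that by linarith
          then show ?thesis unfolding mem_box_cart b_def
            by (auto simp: abs_less_iff minus_less_iff)
        qed
        then show "\<forall>\<^sub>F n in sequentially. indicator (box (- b n) (b n)) x * k x = k x"
          unfolding eventually_sequentially by (intro exI[of _ N]) auto
      qed
      show "(\<lambda>x. indicator (box (- b n) (b n)) x * k x) \<in> borel_measurable lebesgue" for n
        by (rule borel_measurable_integrable[OF iA]) simp
    qed (use k in \<open>auto simp: indicator_def\<close>)
    then show ?thesis by (simp add: box LIMSEQ_const_iff)
  qed
  have borel: "(\<integral>x. indicator A x * k x \<partial>lebesgue) = 0" if "A \<in> sets borel" for A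
  proof -
    have A: "A \<in> sigma_sets UNIV (range (\<lambda>(a, b). box a b))"
      using that by (simp add: borel_eq_box)
    have st: "Int_stable (range (\<lambda>(a, b). box a b :: (real^'n) set))"
      by (auto simp: Int_stable_def box_Int_box)
    have sb: "A \<in> sets lebesgue" if "A \<in> sigma_sets UNIV (range (\<lambda>(a, b). box a b))"
      for A :: "(real^'n) set"
    proof -
      have "A \<in> sets borel" using that by (simp add: borel_eq_box)
      then show ?thesis by simp
    qed
    have G: "range (\<lambda>(a, b). box a b :: (real^'n) set) \<subseteq> Pow UNIV" by simp
    from st G A show ?thesis
    proof (induction rule: sigma_sets_induct_disjoint)
      case (compl A)
      have "(\<integral>x. indicator (UNIV - A) x * k x \<partial>lebesgue) = (\<integral>x. k x - indicator A x * k x \<partial>lebesgue)"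
        by (intro Bochner_Integration.integral_cong) (auto simp: indicator_def)
      then show ?case using compl tot k iA[OF sb[OF compl(1)]] by simp
    next
      case (union A)
      have m: "\<And>i. A i \<in> sets lebesgue" using union(2) sb by auto
      have "(\<lambda>n. \<integral>x. indicator (\<Union>i<n. A i) x * k x \<partial>lebesgue) \<longlonglongrightarrow>
          (\<integral>x. indicator (\<Union>i. A i) x * k x \<partial>lebesgue)"
      proof (rule integral_dominated_convergence[where w = "\<lambda>x. \<bar>k x\<bar>"])
        show "AE x in lebesgue. (\<lambda>n. indicator (\<Union>i<n. A i) x * k x) \<longlonglongrightarrow> indicator (\<Union>i. A i) x * k x"
          by (intro AE_I2 tendsto_intros LIMSEQ_indicator_UN)
        show "(\<lambda>x. indicator (\<Union>i<n. A i) x * k x) \<in> borel_measurable lebesgue" for n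
          by (rule borel_measurable_integrable[OF iA]) (use m in auto)
        show "(\<lambda>x. indicator (\<Union>i. A i) x * k x) \<in> borel_measurable lebesgue"
          by (rule borel_measurable_integrable[OF iA]) (use m in auto)
      qed (use k in \<open>auto simp: indicator_def\<close>)
      moreover have "(\<integral>x. indicator (\<Union>i<n. A i) x * k x \<partial>lebesgue) = 0" for n
      proof (induction n)
        case (Suc n)
        have "A i \<inter> A n = {}" if "i < n" for i using disjoint_family_onD[OF union(1), of i n] that by simp
        then have "(\<integral>x. indicator (\<Union>i<Suc n. A i) x * k x \<partial>lebesgue) =
            (\<integral>x. indicator (\<Union>i<n. A i) x * k x + indicator (A n) x * k x \<partial>lebesgue)"
          by (intro Bochner_Integration.integral_cong) (auto simp: indicator_def lessThan_Suc)
        also have "\<dots> = 0" using iA[of "\<Union>i<n. A i"] iA[OF m[of n]] m Suc union(3)[of n] by simp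
        finally show ?case .
      qed simp
      ultimately show ?case by (simp add: LIMSEQ_const_iff)
    qed (auto simp: box)
  qed
  have leb: "(\<integral>x. indicator A x * k x \<partial>lebesgue) = 0" if lA: "A \<in> sets lebesgue" for A
  proof -
    obtain N where N: "N \<in> null_sets lborel" "null_part lborel A \<subseteq> N" using null_part[OF lA] by blast
    have "AE x in lebesgue. x \<notin> N" using N(1) by (intro AE_completion AE_not_in)
    then have "AE x in lebesgue. (x \<in> A) = (x \<in> main_part lborel A)"
    proof eventually_elim
      case (elim x)
      with main_part_null_part_Un[OF lA] N(2) show ?case by blast
    qed
    then have "(\<integral>x. indicator A x * k x \<partial>lebesgue) = (\<integral>x. indicator (main_part lborel A) x * k x \<partial>lebesgue)"
      using iA[OF lA] iA[of "main_part lborel A"] main_part_sets[OF lA]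
      by (intro integral_cong_AE borel_measurable_integrable) (auto simp: indicator_def elim!: eventually_mono)
    also have "\<dots> = 0" using main_part_sets[OF lA] by (intro borel) simp
    finally show ?thesis .
  qed
  have "AE x in lebesgue. 0 \<le> k x"
    by (rule AE_nonneg_if_set_integrals_nonneg[OF k]) (simp add: leb)
  moreover have "AE x in lebesgue. 0 \<le> - k x"
    by (rule AE_nonneg_if_set_integrals_nonneg) (use k leb in auto)
  ultimately show ?thesis by eventually_elim auto
qed

text \<open>A box whose closure lies in \<open>\<Omega>\<close> has an indicator that is a bounded limit of test functions
  supported in its closure, so the integral of \<open>h\<close> over it vanishes. Countably many closed boxes
  exhaust \<open>\<Omega>\<close>.\<close>

lemma fundamental_lemma_of_calculus_of_variations:
  fixes h :: "real^'n::finite \<Rightarrow> real"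
  assumes \<Omega>: "open \<Omega>" and h: "locally_integrable \<Omega> h"
    and zero: "\<And>\<phi>. \<phi> \<in> test_functions \<Omega> \<Longrightarrow> (\<integral>x. \<phi> x * h x \<partial>lebesgue_on \<Omega>) = 0"
  shows "AE x in lebesgue_on \<Omega>. h x = 0"
proof -
  have \<Omega>': "\<Omega> \<in> sets lebesgue" using \<Omega> by auto
  have ib: "integrable lebesgue (\<lambda>x. indicator (box a b) x * h x)" if "cbox a b \<subseteq> \<Omega>" for a b
  proof -
    have "integrable lebesgue (\<lambda>x. indicator (cbox a b) x * h x)"
      using h that by (simp add: locally_integrable_def integrable_lebesgue_on_iff[symmetric])
    from integrable_mult_indicator[OF _ this, of "box a b"]
    have "integrable lebesgue (\<lambda>x. indicator (box a b) x * (indicator (cbox a b) x * h x))" by simp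
    also have "(\<lambda>x. indicator (box a b) x * (indicator (cbox a b) x * h x)) = (\<lambda>x. indicator (box a b) x * h x)"
      using box_subset_cbox[of a b] by (auto simp: fun_eq_iff indicator_def)
    finally show ?thesis .
  qed
  have ib0: "(\<integral>x. indicator (box a b) x * h x \<partial>lebesgue) = 0" if ab: "cbox a b \<subseteq> \<Omega>" for a b
  proof -
    have supp: "box_bump (real (Suc n)) a b x \<noteq> 0 \<longleftrightarrow> x \<in> box a b" for n x
      by (rule box_bump_nonzero_iff) simp
    have e: "box_bump (real (Suc n)) a b x * h x = box_bump (real (Suc n)) a b x * (indicator (box a b) x * h x)" for n x
      using supp[of n x] by (auto simp: indicator_def)
    have "(\<lambda>n. \<integral>x. box_bump (real (Suc n)) a b x * (indicator (box a b) x * h x) \<partial>lebesgue) \<longlonglongrightarrow>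
       (\<integral>x. indicator (box a b) x * (indicator (box a b) x * h x) \<partial>lebesgue)"
    proof (rule integral_dominated_convergence[where w = "\<lambda>x. \<bar>indicator (box a b) x * h x\<bar>"])
      have "continuous_on UNIV (box_bump (real (Suc n)) a b)" for n
        using box_bump_smooth[of "real (Suc n)" a b] k_times_cont_diff_continuous[of 0]
        unfolding smooth_fun_def by blast
      then show "(\<lambda>x. box_bump (real (Suc n)) a b x * (indicator (box a b) x * h x)) \<in> borel_measurable lebesgue" for n
        by (intro borel_measurable_times continuous_imp_lebesgue_measurable borel_measurable_integrable[OF ib[OF ab]])
      show "AE x in lebesgue. norm (box_bump (real (Suc n)) a b x * (indicator (box a b) x * h x))
          \<le> \<bar>indicator (box a b) x * h x\<bar>" for n
        using box_bump_bounds[of "real (Suc n)" a b]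
        by (intro AE_I2) (auto simp: abs_mult intro!: mult_left_le_one_le)
      show "AE x in lebesgue. (\<lambda>n. box_bump (real (Suc n)) a b x * (indicator (box a b) x * h x)) \<longlonglongrightarrow>
          indicator (box a b) x * (indicator (box a b) x * h x)"
        by (intro AE_I2 tendsto_intros box_bump_tendsto_indicator)
      show "(\<lambda>x. indicator (box a b) x * (indicator (box a b) x * h x)) \<in> borel_measurable lebesgue"
        by (intro borel_measurable_times borel_measurable_indicator borel_measurable_integrable[OF ib[OF ab]]) simp
      show "integrable lebesgue (\<lambda>x. \<bar>indicator (box a b) x * h x\<bar>)"
        by (rule integrable_abs[OF ib[OF ab]])
    qed
    moreover have "(\<integral>x. box_bump (real (Suc n)) a b x * (indicator (box a b) x * h x) \<partial>lebesgue) = 0" for n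
    proof -
      have "0 = (\<integral>x. indicator \<Omega> x * (box_bump (real (Suc n)) a b x * h x) \<partial>lebesgue)"
        using zero[OF box_bump_test_function[OF ab, of "real (Suc n)"]] \<Omega>'
        by (simp add: integral_lebesgue_on_eq del: of_nat_Suc)
      also have "\<dots> = (\<integral>x. box_bump (real (Suc n)) a b x * (indicator (box a b) x * h x) \<partial>lebesgue)"
        using ab box_subset_cbox[of a b] supp[of n]
        by (intro Bochner_Integration.integral_cong) (auto simp: indicator_def)
      finally show ?thesis by simp
    qed
    ultimately have "(\<integral>x. indicator (box a b) x * (indicator (box a b) x * h x) \<partial>lebesgue) = 0"
      by (simp add: LIMSEQ_const_iff)
    then show ?thesis by (simp add: mult.assoc[symmetric] indicator_inter_arith[symmetric])
  qed
  have box0: "AE x in lebesgue. x \<in> cbox a b \<longrightarrow> h x = 0" if ab: "cbox a b \<subseteq> \<Omega>" for a b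
  proof -
    have "AE x in lebesgue. indicator (box a b) x * h x = 0"
    proof (rule AE_zero_if_box_integrals_zero[OF ib[OF ab]])
      fix c d :: "real^'n"
      obtain u v where uv: "box c d \<inter> box a b = box u v" using that unfolding box_Int_box by blast
      have "(\<integral>x. indicator (box u v) x * h x \<partial>lebesgue) = 0"
      \<comment> \<open>An empty box gives no control over \<open>cbox u v\<close>, so this case is separate.\<close>
      proof (cases "box u v = {}")
        case False
        then have "cbox u v = closure (box u v)" by simp
        also have "\<dots> \<subseteq> closure (box a b)" by (intro closure_mono) (use uv in auto)
        also have "\<dots> \<subseteq> cbox a b" by (intro closure_minimal box_subset_cbox closed_cbox)
        finally show ?thesis using ab by (intro ib0) auto
      qed simp
      then show "(\<integral>x. indicator (box c d) x * (indicator (box a b) x * h x) \<partial>lebesgue) = 0"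
        by (simp add: mult.assoc[symmetric] indicator_inter_arith[symmetric] uv)
    qed
    moreover have "AE x in lebesgue. x \<notin> cbox a b - box a b"
      using negligible_frontier_interval[of a b]
      by (intro AE_not_in) (simp add: negligible_iff_null_sets)
    ultimately show ?thesis by eventually_elim (auto simp: indicator_def split: if_splits)
  qed
  obtain D where D: "countable D" "D \<subseteq> Pow \<Omega>" "\<And>X. X \<in> D \<Longrightarrow> \<exists>a b. X = cbox a b" "\<Union>D = \<Omega>"
    by (rule open_countable_Union_open_cbox[OF \<Omega>]) (rule that)
  have "AE x in lebesgue. \<forall>X\<in>D. x \<in> X \<longrightarrow> h x = 0"
  proof (rule AE_ball_countable'[OF _ D(1)])
    fix X assume X: "X \<in> D"
    then obtain a b where "X = cbox a b" using D(3) by blast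
    with D(2) X show "AE x in lebesgue. x \<in> X \<longrightarrow> h x = 0" using box0[of a b] by auto
  qed
  then have 1: "AE x in lebesgue. x \<in> \<Omega> \<longrightarrow> h x = 0"
  proof eventually_elim
    case (elim x)
    with D(4) show ?case by blast
  qed
  have 2: "\<Omega> \<inter> space lebesgue \<in> sets lebesgue" using \<Omega>' by simp
  show ?thesis by (rule AE_restrict_space_iff[OF 2, THEN iffD2, OF 1])
qed

lemma weak_gradient_unique:
  assumes \<Omega>: "open \<Omega>" and G: "has_weak_gradient h G \<Omega>" and G': "has_weak_gradient h G' \<Omega>"
  shows "AE x in lebesgue_on \<Omega>. G x $ j = G' x $ j"
proof -
  have l: "locally_integrable \<Omega> (\<lambda>x. G x $ j)" "locally_integrable \<Omega> (\<lambda>x. G' x $ j)"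
    using G G' by (auto simp: has_weak_gradient_def)
  have "AE x in lebesgue_on \<Omega>. G x $ j - G' x $ j = 0"
  proof (rule fundamental_lemma_of_calculus_of_variations[OF \<Omega>])
    show "locally_integrable \<Omega> (\<lambda>x. G x $ j - G' x $ j)"
      using l unfolding locally_integrable_def by auto
    fix \<phi> assume \<phi>: "\<phi> \<in> test_functions \<Omega>"
    have "(\<integral>x. \<phi> x * (G x $ j - G' x $ j) \<partial>lebesgue_on \<Omega>) =
        (\<integral>x. \<phi> x * G x $ j \<partial>lebesgue_on \<Omega>) - (\<integral>x. \<phi> x * G' x $ j \<partial>lebesgue_on \<Omega>)"
      unfolding right_diff_distrib
      by (intro Bochner_Integration.integral_diff test_function_integrable[OF \<Omega>] l \<phi>)
    also have "\<dots> = 0" using G G' \<phi> unfolding has_weak_gradient_def by force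
    finally show "(\<integral>x. \<phi> x * (G x $ j - G' x $ j) \<partial>lebesgue_on \<Omega>) = 0" .
  qed
  then show ?thesis by simp
qed

section \<open>Selecting functionals from almost-everywhere linear families\<close>

text \<open>The bound makes \<open>d\<close> Lipschitz, so it extends continuously to the closure of \<open>S\<close>, and the
  algebraic identities pass to limits; real homogeneity comes from approximating the scalar by
  rationals and the vector from \<open>S\<close> simultaneously.\<close>

lemma bounded_rational_linear_extends:
  fixes S :: "'y::real_normed_vector set" and d :: "'y \<Rightarrow> real"
  assumes dense: "closure S = UNIV"
    and S_add: "\<And>v w. v \<in> S \<Longrightarrow> w \<in> S \<Longrightarrow> v + w \<in> S"
    and S_scale: "\<And>q v. v \<in> S \<Longrightarrow> real_of_rat q *\<^sub>R v \<in> S"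
    and d_add: "\<And>v w. v \<in> S \<Longrightarrow> w \<in> S \<Longrightarrow> d (v + w) = d v + d w"
    and d_scale: "\<And>q v. v \<in> S \<Longrightarrow> d (real_of_rat q *\<^sub>R v) = real_of_rat q * d v"
    and d_bound: "\<And>v. v \<in> S \<Longrightarrow> \<bar>d v\<bar> \<le> norm v * K"
    and K: "0 \<le> K"
  obtains F :: "'y \<Rightarrow>\<^sub>L real" where "\<And>v. v \<in> S \<Longrightarrow> blinfun_apply F v = d v" "norm F \<le> K"
proof -
  have neg: "- v \<in> S" "d (- v) = - d v" if "v \<in> S" for v
    using S_scale[OF that, of "-1"] d_scale[OF that, of "-1"] by (auto simp: of_rat_minus)
  have lip: "\<bar>d v - d w\<bar> \<le> norm (v - w) * K" if "v \<in> S" "w \<in> S" for v w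
    using d_bound[OF S_add[OF that(1) neg(1)[OF that(2)]]] d_add[OF that(1) neg(1)[OF that(2)]]
      neg(2)[OF that(2)] by simp
  have "uniformly_continuous_on S d"
  proof (unfold uniformly_continuous_on_def, intro allI impI)
    fix e :: real assume e: "0 < e"
    show "\<exists>\<delta>>0. \<forall>x\<in>S. \<forall>x'\<in>S. dist x' x < \<delta> \<longrightarrow> dist (d x') (d x) < e"
    proof (intro exI[of _ "e / (K + 1)"] conjI ballI impI)
      fix x x' assume x: "x \<in> S" "x' \<in> S" "dist x' x < e / (K + 1)"
      have "\<bar>d x' - d x\<bar> \<le> norm (x' - x) * (K + 1)"
        using lip[OF x(2,1)] mult_left_mono[of K "K + 1" "norm (x' - x)"] by simp
      also have "\<dots> < e" using x(3) K by (simp add: dist_norm pos_less_divide_eq)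
      finally show "dist (d x') (d x) < e" by (simp add: dist_norm)
    qed (use e K in auto)
  qed
  then obtain F where F: "uniformly_continuous_on (closure S) F" "\<And>x. x \<in> S \<Longrightarrow> d x = F x"
    by (rule uniformly_continuous_on_extension_on_closure) blast
  have cont: "isCont F v" for v
    using uniformly_continuous_imp_continuous[OF F(1)]
    by (auto simp: dense continuous_on_eq_continuous_at)
  have seq: "\<exists>s. (\<forall>n. s n \<in> S) \<and> s \<longlonglongrightarrow> v" for v
    using dense closure_sequential[of v S] by auto
  have lim: "(\<lambda>n. d (s n)) \<longlonglongrightarrow> F v" if "\<forall>n. s n \<in> S" "s \<longlonglongrightarrow> v" for s v
    using isCont_tendsto_compose[OF cont[of v] that(2)] that(1) F(2) by simp
  have F_add: "F (v + w) = F v + F w" for v w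
  proof -
    obtain s t where st: "\<forall>n. s n \<in> S" "s \<longlonglongrightarrow> v" "\<forall>n. t n \<in> S" "t \<longlonglongrightarrow> w"
      using seq by metis
    have "(\<lambda>n. d (s n + t n)) \<longlonglongrightarrow> F (v + w)"
      by (rule lim) (use st S_add in \<open>auto intro: tendsto_add\<close>)
    moreover have "(\<lambda>n. d (s n + t n)) \<longlonglongrightarrow> F v + F w"
      using tendsto_add[OF lim[OF st(1,2)] lim[OF st(3,4)]] st d_add by simp
    ultimately show ?thesis by (rule LIMSEQ_unique)
  qed
  have F_scale: "F (r *\<^sub>R v) = r * F v" for r v
  proof -
    obtain s where s: "\<forall>n. s n \<in> S" "s \<longlonglongrightarrow> v" using seq by metis
    have "r \<in> closure \<rat>" by (simp add: Rats_closure_real)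
    then obtain q where q: "\<forall>n. q n \<in> \<rat>" "q \<longlonglongrightarrow> r" unfolding closure_sequential by blast
    have S': "q n *\<^sub>R s n \<in> S" "d (q n *\<^sub>R s n) = q n * d (s n)" for n
    proof -
      obtain c where "q n = real_of_rat c" using q(1) Rats_cases by metis
      then show "q n *\<^sub>R s n \<in> S" "d (q n *\<^sub>R s n) = q n * d (s n)"
        using S_scale[of "s n" c] d_scale[of "s n" c] s(1) by auto
    qed
    have "(\<lambda>n. d (q n *\<^sub>R s n)) \<longlonglongrightarrow> F (r *\<^sub>R v)"
      by (rule lim) (use S' s q in \<open>auto intro: tendsto_scaleR\<close>)
    moreover have "(\<lambda>n. d (q n *\<^sub>R s n)) \<longlonglongrightarrow> r * F v"
      unfolding S'(2) by (intro tendsto_mult q lim[OF s])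
    ultimately show ?thesis by (rule LIMSEQ_unique)
  qed
  have F_bound: "\<bar>F v\<bar> \<le> norm v * K" for v
  proof -
    obtain s where s: "\<forall>n. s n \<in> S" "s \<longlonglongrightarrow> v" using seq by metis
    show ?thesis
      by (rule LIMSEQ_le[OF tendsto_rabs[OF lim[OF s]] tendsto_mult[OF tendsto_norm[OF s(2)] tendsto_const]])
         (use s d_bound in auto)
  qed
  have bl: "bounded_linear F"
    by (rule bounded_linear_intro[of F K]) (use F_add F_scale F_bound in auto)
  show thesis
  proof (rule that[of "Blinfun F"])
    show "norm (Blinfun F) \<le> K"
      by (rule norm_blinfun_bound[OF K]) (use F_bound in \<open>simp add: bounded_linear_Blinfun_apply[OF bl] mult.commute\<close>)
  qed (simp add: bounded_linear_Blinfun_apply[OF bl] F(2))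
qed

text \<open>A countable set that is closed under the linear operations is needed, because only countably many
  almost-everywhere identities can be imposed at the same point; this forces rational scalars.\<close>

lemma countable_dense_rational_subspace:
  assumes "separable_space (euclidean :: 'y::real_normed_vector topology)"
  obtains S :: "'y::real_normed_vector set" where "countable S" "closure S = UNIV"
    "\<And>v w. v \<in> S \<Longrightarrow> w \<in> S \<Longrightarrow> v + w \<in> S" "\<And>q v. v \<in> S \<Longrightarrow> real_of_rat q *\<^sub>R v \<in> S"
proof -
  obtain C :: "'y set" where C: "countable C" "closure C = UNIV"
    using assms by (auto simp: separable_space_def)
  define eval where "eval xs = (\<Sum>(q, v)\<leftarrow>xs. real_of_rat q *\<^sub>R v)" for xs :: "(rat \<times> 'y) list"
  define S where "S = eval ` lists (UNIV \<times> C)"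
  have "countable S" unfolding S_def using C(1) by (intro countable_image countable_lists) auto
  moreover have "C \<subseteq> S"
  proof
    fix v assume "v \<in> C"
    then show "v \<in> S" unfolding S_def eval_def by (intro image_eqI[of _ _ "[(1, v)]"]) auto
  qed
  then have "closure S = UNIV" using C(2) closure_mono by blast
  moreover have "v + w \<in> S" if vw: "v \<in> S" "w \<in> S" for v w
  proof -
    obtain xs ys where "v = eval xs" "w = eval ys" "xs \<in> lists (UNIV \<times> C)" "ys \<in> lists (UNIV \<times> C)"
      using vw by (auto simp: S_def)
    then show ?thesis unfolding S_def by (intro image_eqI[of _ _ "xs @ ys"]) (auto simp: eval_def)
  qed
  moreover have "real_of_rat q *\<^sub>R v \<in> S" if v: "v \<in> S" for q v
  proof -
    obtain xs where xs: "v = eval xs" "xs \<in> lists (UNIV \<times> C)" using v by (auto simp: S_def)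
    have "real_of_rat q *\<^sub>R eval xs = eval (map (\<lambda>(p, v). (q * p, v)) xs)"
      unfolding eval_def by (induction xs) (auto simp: scaleR_right_distrib of_rat_mult)
    then show ?thesis unfolding S_def xs(1) using xs(2)
      by (intro image_eqI[of _ _ "map (\<lambda>(p, v). (q * p, v)) xs"]) auto
  qed
  ultimately show thesis by (rule that)
qed

lemma norm_blinfun_le_iff_dense:
  fixes F :: "'y::real_normed_vector \<Rightarrow>\<^sub>L real"
  assumes "closure S = UNIV" "0 \<le> a"
  shows "norm F \<le> a \<longleftrightarrow> (\<forall>v\<in>S. \<bar>blinfun_apply F v\<bar> \<le> a * norm v)"
proof
  assume "norm F \<le> a"
  then show "\<forall>v\<in>S. \<bar>blinfun_apply F v\<bar> \<le> a * norm v"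
    using norm_blinfun[of F] by (metis mult_right_mono norm_ge_zero order_trans real_norm_def)
next
  assume le: "\<forall>v\<in>S. \<bar>blinfun_apply F v\<bar> \<le> a * norm v"
  have "closed {v. \<bar>blinfun_apply F v\<bar> \<le> a * norm v}"
    by (intro closed_Collect_le continuous_intros)
  then have "closure S \<subseteq> {v. \<bar>blinfun_apply F v\<bar> \<le> a * norm v}"
    using le by (intro closure_minimal) auto
  with assms(1) have "\<And>v. \<bar>blinfun_apply F v\<bar> \<le> a * norm v" by auto
  then show "norm F \<le> a" by (intro norm_blinfun_bound assms(2)) auto
qed

text \<open>By separability the norm is determined by countably many evaluations. Without it the norm
  of a weak* measurable map can fail to be measurable.\<close>

lemma norm_weak_star_measurable:
  fixes F :: "'a \<Rightarrow> ('y::real_normed_vector \<Rightarrow>\<^sub>L real)"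
  assumes sep: "separable_space (euclidean :: 'y topology)"
    and m: "\<And>v. (\<lambda>x. blinfun_apply (F x) v) \<in> borel_measurable M"
  shows "(\<lambda>x. norm (F x)) \<in> borel_measurable M"
proof -
  obtain S :: "'y set" where S: "countable S" "closure S = UNIV"
    using countable_dense_rational_subspace[OF sep] by metis
  show ?thesis unfolding borel_measurable_iff_le
  proof
    fix a :: real
    show "{x \<in> space M. norm (F x) \<le> a} \<in> sets M"
    proof (cases "0 \<le> a")
      case True
      have "S \<noteq> {}" using S(2) by auto
      then have "{x \<in> space M. norm (F x) \<le> a} = (\<Inter>v\<in>S. {x \<in> space M. \<bar>blinfun_apply (F x) v\<bar> \<le> a * norm v})"
        using norm_blinfun_le_iff_dense[OF S(2) True] by auto
      also have "\<dots> \<in> sets M"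
        using \<open>S \<noteq> {}\<close> borel_measurable_le[OF borel_measurable_abs[OF m] borel_measurable_const]
        by (intro sets.countable_INT' S(1)) auto
      finally show ?thesis .
    next
      case False
      then have "{x \<in> space M. norm (F x) \<le> a} = {}"
        by (auto dest: order_trans[OF norm_ge_zero])
      then show ?thesis by (simp only: sets.empty_sets)
    qed
  qed
qed

text \<open>Each \<open>D v\<close> is a class of functions modulo null sets, and \<open>v \<mapsto> D v\<close> is linear only modulo null
  sets that depend on the vectors. On a countable dense rational subspace the exceptional sets
  have a null union; off it the values at a point form a bounded rational-linear functional, which
  extends to an element of the dual. For the remaining vectors the bound forces agreement almost
  everywhere.\<close>

lemma weak_star_density_selection:
  fixes D :: "'y::real_normed_vector \<Rightarrow> 'a \<Rightarrow> real"
  assumes sep: "separable_space (euclidean :: 'y topology)"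
    and D_meas: "\<And>v. D v \<in> borel_measurable M"
    and D_add: "\<And>v w. AE x in M. D (v + w) x = D v x + D w x"
    and D_scale: "\<And>c v. AE x in M. D (c *\<^sub>R v) x = c * D v x"
    and D_bound: "\<And>v. AE x in M. \<bar>D v x\<bar> \<le> norm v * g x"
  obtains F :: "'a \<Rightarrow> ('y \<Rightarrow>\<^sub>L real)" where
    "\<And>v. (\<lambda>x. blinfun_apply (F x) v) \<in> borel_measurable M"
    "\<And>v. AE x in M. blinfun_apply (F x) v = D v x"
    "\<And>x. norm (F x) \<le> \<bar>g x\<bar>"
proof -
  obtain S :: "'y set" where S: "countable S" "closure S = UNIV"
    "\<And>v w. v \<in> S \<Longrightarrow> w \<in> S \<Longrightarrow> v + w \<in> S" "\<And>q v. v \<in> S \<Longrightarrow> real_of_rat q *\<^sub>R v \<in> S"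
    using countable_dense_rational_subspace[OF sep] by metis
  define good where "good x \<longleftrightarrow> (\<forall>v\<in>S. \<forall>w\<in>S. D (v + w) x = D v x + D w x) \<and>
     (\<forall>v\<in>S. \<forall>q. D (real_of_rat q *\<^sub>R v) x = real_of_rat q * D v x) \<and>
     (\<forall>v\<in>S. \<bar>D v x\<bar> \<le> norm v * g x)" for x
  have "AE x in M. good x"
    unfolding good_def
    by (intro AE_conjI AE_ball_countable'[OF _ S(1)] AE_all_countable[THEN iffD2] allI
        D_add D_scale D_bound)
  then obtain N where N: "N \<in> null_sets M" "\<And>x. x \<in> space M \<Longrightarrow> \<not> good x \<Longrightarrow> x \<in> N"
    by (rule AE_E3) blast
  have "\<exists>F. (\<forall>v\<in>S. blinfun_apply F v = D v x) \<and> norm F \<le> \<bar>g x\<bar>" if "good x" for x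
  proof -
    have b: "\<bar>D v x\<bar> \<le> norm v * \<bar>g x\<bar>" if "v \<in> S" for v
      using \<open>good x\<close> that unfolding good_def
      by (meson abs_ge_self mult_left_mono norm_ge_zero order_trans)
    show ?thesis
      by (rule bounded_rational_linear_extends[OF S(2,3,4), of "\<lambda>v. D v x" "\<bar>g x\<bar>"])
         (use \<open>good x\<close> b in \<open>auto simp: good_def\<close>)
  qed
  then obtain F0 where F0: "\<And>x v. good x \<Longrightarrow> v \<in> S \<Longrightarrow> blinfun_apply (F0 x) v = D v x"
    "\<And>x. good x \<Longrightarrow> norm (F0 x) \<le> \<bar>g x\<bar>" by metis
  \<comment> \<open>The set of bad points need not be measurable, so \<open>F\<close> is made zero on the null set \<open>N\<close> as well.\<close>
  define F where "F x = (if x \<in> N \<or> \<not> good x then 0 else F0 x)" for x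
  have nF: "norm (F x) \<le> \<bar>g x\<bar>" for x using F0(2)[of x] by (auto simp: F_def)
  have AE_N: "AE x in M. x \<notin> N" by (rule AE_not_in[OF N(1)])
  have mS: "(\<lambda>x. blinfun_apply (F x) v) \<in> borel_measurable M" if "v \<in> S" for v
  proof -
    have "(\<lambda>x. indicator (space M - N) x * D v x) \<in> borel_measurable M"
      using N(1) D_meas by (intro borel_measurable_times borel_measurable_indicator) auto
    also have "?this \<longleftrightarrow> ?thesis"
      using N(2) F0(1)[OF _ that] by (intro measurable_cong) (auto simp: F_def indicator_def)
    finally show ?thesis .
  qed
  have seq: "\<exists>s. (\<forall>n. s n \<in> S) \<and> s \<longlonglongrightarrow> v" for v
    using S(2) closure_sequential[of v S] by auto
  have limF: "(\<lambda>n. blinfun_apply (F x) (s n)) \<longlonglongrightarrow> blinfun_apply (F x) v" if "s \<longlonglongrightarrow> v" for x s v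
    using that by (intro tendsto_intros)
  show thesis
  proof
    show "(\<lambda>x. blinfun_apply (F x) v) \<in> borel_measurable M" for v
    proof -
      obtain s where s: "\<forall>n. s n \<in> S" "s \<longlonglongrightarrow> v" using seq by metis
      show ?thesis
        by (rule borel_measurable_LIMSEQ_real[of M "\<lambda>n x. blinfun_apply (F x) (s n)"])
           (use mS s limF in auto)
    qed
    show "norm (F x) \<le> \<bar>g x\<bar>" for x by (rule nF)
    show "AE x in M. blinfun_apply (F x) v = D v x" for v
    proof -
      obtain s where s: "\<forall>n. s n \<in> S" "s \<longlonglongrightarrow> v" using seq by metis
      have "AE x in M. \<forall>n. \<bar>D (s n + (-1) *\<^sub>R v) x\<bar> \<le> norm (s n + (-1) *\<^sub>R v) * g x"
        "AE x in M. \<forall>n. D (s n + (-1) *\<^sub>R v) x = D (s n) x + D ((-1) *\<^sub>R v) x"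
        using D_bound D_add unfolding AE_all_countable by blast+
      with AE_N AE_space D_scale[of "-1" v] show ?thesis
      proof eventually_elim
        case (elim x)
        have gx: "good x" and FS: "blinfun_apply (F x) (s n) = D (s n) x" for n
          using elim N(2)[of x] F0(1)[of x] s(1) by (auto simp: F_def)
        have "(\<lambda>n. norm (s n - v) * g x) \<longlonglongrightarrow> norm (v - v) * g x"
          by (intro tendsto_intros s(2))
        then have "(\<lambda>n. norm (s n - v) * g x) \<longlonglongrightarrow> 0" by simp
        moreover have "\<forall>\<^sub>F n in sequentially. norm (D (s n) x - D v x) \<le> norm (s n - v) * g x"
        proof (rule always_eventually, rule allI)
          show "norm (D (s n) x - D v x) \<le> norm (s n - v) * g x" for n
            using elim(4)[rule_format, of n] elim(5)[rule_format, of n] elim(3) by simp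
        qed
        ultimately have "(\<lambda>n. D (s n) x - D v x) \<longlonglongrightarrow> 0"
          by (rule Lim_null_comparison[rotated])
        then have "(\<lambda>n. D (s n) x) \<longlonglongrightarrow> D v x" by (simp add: LIM_zero_iff)
        with limF[OF s(2), of x] show ?case unfolding FS by (rule LIMSEQ_unique)
      qed
    qed
  qed
qed

section \<open>Gelfand integrals and the bidual\<close>

lemma gelfand_integral_exists:
  fixes F :: "'a \<Rightarrow> ('y::real_normed_vector \<Rightarrow>\<^sub>L real)" and \<psi> :: "'a \<Rightarrow> real"
  assumes F: "\<And>v. (\<lambda>x. blinfun_apply (F x) v) \<in> borel_measurable M"
    and \<psi>: "\<psi> \<in> borel_measurable M" and k: "integrable M (\<lambda>x. \<psi> x * norm (F x))"
  obtains w :: "'y \<Rightarrow>\<^sub>L real" where "\<And>v. integrable M (\<lambda>x. \<psi> x * blinfun_apply (F x) v)"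
    "\<And>v. blinfun_apply w v = (\<integral>x. \<psi> x * blinfun_apply (F x) v \<partial>M)"
    "norm w \<le> (\<integral>x. \<bar>\<psi> x\<bar> * norm (F x) \<partial>M)"
proof -
  have k': "integrable M (\<lambda>x. \<bar>\<psi> x\<bar> * norm (F x))"
    using integrable_abs[OF k] by (simp add: abs_mult)
  have b: "\<bar>\<psi> x * blinfun_apply (F x) v\<bar> \<le> \<bar>\<psi> x\<bar> * norm (F x) * norm v" for x v
    using mult_left_mono[OF norm_blinfun[of "F x" v] abs_ge_zero[of "\<psi> x"]]
    by (simp add: abs_mult mult.assoc)
  have i: "integrable M (\<lambda>x. \<psi> x * blinfun_apply (F x) v)" for v
  proof (rule Bochner_Integration.integrable_bound[OF integrable_mult_left[OF k', of "norm v"]])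
    show "(\<lambda>x. \<psi> x * blinfun_apply (F x) v) \<in> borel_measurable M"
      by (intro borel_measurable_times \<psi> F)
    show "AE x in M. norm (\<psi> x * blinfun_apply (F x) v) \<le> norm (\<bar>\<psi> x\<bar> * norm (F x) * norm v)"
      using order_trans[OF b abs_ge_self] by (intro AE_I2) (simp only: real_norm_def)
  qed
  have k0: "0 \<le> (\<integral>x. \<bar>\<psi> x\<bar> * norm (F x) \<partial>M)" by simp
  have B: "\<bar>\<integral>x. \<psi> x * blinfun_apply (F x) v \<partial>M\<bar> \<le> norm v * (\<integral>x. \<bar>\<psi> x\<bar> * norm (F x) \<partial>M)" for v
  proof -
    have "\<bar>\<integral>x. \<psi> x * blinfun_apply (F x) v \<partial>M\<bar> \<le> (\<integral>x. \<bar>\<psi> x * blinfun_apply (F x) v\<bar> \<partial>M)"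
      by (rule integral_abs_bound)
    also have "\<dots> \<le> (\<integral>x. \<bar>\<psi> x\<bar> * norm (F x) * norm v \<partial>M)"
      by (rule integral_mono[OF integrable_abs[OF i] integrable_mult_left[OF k'] b])
    finally show ?thesis by (simp add: mult.commute)
  qed
  have bl: "bounded_linear (\<lambda>v. \<integral>x. \<psi> x * blinfun_apply (F x) v \<partial>M)"
    by (rule bounded_linear_intro[where K = "\<integral>x. \<bar>\<psi> x\<bar> * norm (F x) \<partial>M"])
       (use i B in \<open>auto simp: blinfun.add_right blinfun.scaleR_right distrib_left mult.left_commute\<close>)
  show thesis
  proof (rule that[of "Blinfun (\<lambda>v. \<integral>x. \<psi> x * blinfun_apply (F x) v \<partial>M)", OF i])
    show "norm (Blinfun (\<lambda>v. \<integral>x. \<psi> x * blinfun_apply (F x) v \<partial>M)) \<le> (\<integral>x. \<bar>\<psi> x\<bar> * norm (F x) \<partial>M)"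
      by (rule norm_blinfun_bound[OF k0])
         (use B in \<open>simp add: bounded_linear_Blinfun_apply[OF bl] mult.commute\<close>)
  qed (simp add: bounded_linear_Blinfun_apply[OF bl])
qed

text \<open>A measurable map with essentially separable values is approximated in weighted \<open>L\<^sup>1\<close> by maps with
  finitely many values: countably many small balls cover the range, and all but finitely many of the
  corresponding pieces carry little mass. The error is bounded through a real majorant \<open>r\<close>, because in
  a nonseparable space the difference of two measurable maps need not be measurable.\<close>

lemma weighted_simple_approximation:
  fixes f :: "'a \<Rightarrow> 'z::real_normed_vector" and \<psi> :: "'a \<Rightarrow> real"
  assumes f: "f \<in> borel_measurable M"
    and N: "N \<in> null_sets M" and sep: "separable_space (top_of_set (f ` (space M - N)))"
    and \<psi>: "integrable M \<psi>" and \<psi>f: "integrable M (\<lambda>x. \<psi> x * norm (f x))" and e: "0 < e"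
  obtains m :: nat and A y r where "\<And>k. A k \<in> sets M" "integrable M r" "(\<integral>x. r x \<partial>M) \<le> e"
    "\<And>x. x \<in> space M \<Longrightarrow> \<bar>\<psi> x\<bar> * norm (f x - (\<Sum>k<m. indicator (A k) x *\<^sub>R y k)) \<le> r x"
proof -
  define T where "T = f ` (space M - N)"
  obtain C where C: "countable C" "T \<subseteq> closure C"
  proof -
    from sep obtain C where "countable C" "C \<subseteq> T" "top_of_set T closure_of C = T"
      unfolding separable_space_def T_def[symmetric] by auto
    then have "T \<inter> closure (T \<inter> C) = T" "T \<inter> C = C" by (auto simp: closure_of_subtopology)
    then have "T \<subseteq> closure C" by simp blast
    with that[of C] \<open>countable C\<close> show thesis by blast
  qed
  \<comment> \<open>The point \<open>0\<close> is added so that the set enumerated is nonempty.\<close>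
  define y where "y = from_nat_into (insert 0 C)"
  have ry: "range y = insert 0 C"
    unfolding y_def by (rule range_from_nat_into) (use C in auto)
  define c where "c = (\<integral>x. \<bar>\<psi> x\<bar> \<partial>M)"
  have c0: "0 \<le> c" unfolding c_def by simp
  \<comment> \<open>The denominator \<open>c + 1\<close> is positive even if \<open>\<psi>\<close> vanishes almost everywhere.\<close>
  define \<epsilon> where "\<epsilon> = e / 2 / (c + 1)"
  have \<epsilon>: "0 < \<epsilon>" "\<epsilon> * c \<le> e / 2"
  proof -
    show 0: "0 < \<epsilon>" using e c0 by (simp add: \<epsilon>_def)
    have "\<epsilon> * c \<le> \<epsilon> * (c + 1)" using 0 by simp
    also have "\<dots> = e / 2"
      unfolding \<epsilon>_def using c0 by (intro nonzero_eq_divide_eq[THEN iffD1, OF _ refl]) simp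
    finally show "\<epsilon> * c \<le> e / 2" .
  qed
  define B where "B k = (f -` ball (y k) \<epsilon> \<inter> space M) - N" for k
  define A where "A = disjointed B"
  have Bm: "B k \<in> sets M" for k
    unfolding B_def using N f by (intro sets.Diff measurable_sets[OF f]) auto
  then have Am: "A k \<in> sets M" for k unfolding A_def using sets.range_disjointed_sets[of B M] by auto
  have AB: "A k \<subseteq> B k" for k unfolding A_def by (rule disjointed_subset)
  have dA: "disjoint_family A" unfolding A_def by (rule disjoint_family_disjointed)
  have UA: "space M - N \<subseteq> (\<Union>k. A k)"
  proof
    fix x assume x: "x \<in> space M - N"
    then have "f x \<in> closure C" using C(2) by (auto simp: T_def)
    then obtain z where "z \<in> C" "dist z (f x) < \<epsilon>" using \<epsilon>(1) closure_approachable by metis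
    moreover then obtain k where "z = y k" using ry by blast
    ultimately have "x \<in> B k" using x by (auto simp: B_def)
    then show "x \<in> (\<Union>k. A k)" unfolding A_def UN_disjointed_eq by blast
  qed
  define R where "R m = space M - (\<Union>k<m. A k)" for m
  have Rm: "R m \<in> sets M" for m unfolding R_def using Am by auto
  have i2: "integrable M (\<lambda>x. indicator (R m) x * (\<bar>\<psi> x\<bar> * norm (f x)))" for m
    using integrable_mult_indicator[OF Rm integrable_abs[OF \<psi>f]] by (simp add: abs_mult)
  have "(\<lambda>m. \<integral>x. indicator (R m) x * (\<bar>\<psi> x\<bar> * norm (f x)) \<partial>M) \<longlonglongrightarrow> (\<integral>x. 0 \<partial>M)"
  proof (rule integral_dominated_convergence[where w = "\<lambda>x. \<bar>\<psi> x * norm (f x)\<bar>"])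
    show "AE x in M. (\<lambda>m. indicator (R m) x * (\<bar>\<psi> x\<bar> * norm (f x))) \<longlonglongrightarrow> 0"
      using AE_not_in[OF N] AE_space
    proof eventually_elim
      case (elim x)
      with UA obtain k where k: "x \<in> A k" by blast
      have "\<forall>\<^sub>F m in sequentially. indicator (R m) x * (\<bar>\<psi> x\<bar> * norm (f x)) = 0"
        unfolding eventually_sequentially
        by (rule exI[of _ "Suc k"]) (use k in \<open>auto simp: R_def indicator_def\<close>)
      then show ?case by (rule tendsto_eventually)
    qed
    show "integrable M (\<lambda>x. \<bar>\<psi> x * norm (f x)\<bar>)" by (rule integrable_abs[OF \<psi>f])
  qed (use borel_measurable_integrable[OF i2] in \<open>auto simp: abs_mult indicator_def\<close>)
  then have "(\<lambda>m. \<integral>x. indicator (R m) x * (\<bar>\<psi> x\<bar> * norm (f x)) \<partial>M) \<longlonglongrightarrow> 0" by simp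
  from order_tendstoD(2)[OF this, of "e / 2"] e
  obtain m where m: "(\<integral>x. indicator (R m) x * (\<bar>\<psi> x\<bar> * norm (f x)) \<partial>M) < e / 2"
    by (auto simp: eventually_sequentially)
  define r where "r x = \<epsilon> * \<bar>\<psi> x\<bar> + indicator (R m) x * (\<bar>\<psi> x\<bar> * norm (f x))" for x
  have ir: "integrable M r" unfolding r_def using \<psi> i2 by auto
  show thesis
  proof (rule that[of A r y m, OF Am ir])
    have "(\<integral>x. r x \<partial>M) = \<epsilon> * c + (\<integral>x. indicator (R m) x * (\<bar>\<psi> x\<bar> * norm (f x)) \<partial>M)"
      unfolding r_def c_def using \<psi> i2 by (subst Bochner_Integration.integral_add) auto
    then show "(\<integral>x. r x \<partial>M) \<le> e" using m \<epsilon>(2) by simp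
    fix x assume x: "x \<in> space M"
    show "\<bar>\<psi> x\<bar> * norm (f x - (\<Sum>k<m. indicator (A k) x *\<^sub>R y k)) \<le> r x"
    proof (cases "x \<in> R m")
      case True
      then have "(\<Sum>k<m. indicator (A k) x *\<^sub>R y k) = 0"
        by (intro sum.neutral) (auto simp: R_def indicator_def)
      with True \<epsilon>(1) show ?thesis by (simp add: r_def)
    next
      case False
      then obtain k where k: "k < m" "x \<in> A k" using x by (auto simp: R_def)
      have "indicator (A l) x *\<^sub>R y l = (if l = k then y k else 0)" for l
        using k(2) disjoint_family_onD[OF dA, of l k] by (auto simp: indicator_def)
      then have s: "(\<Sum>k<m. indicator (A k) x *\<^sub>R y k) = y k" using k(1) by simp
      have "norm (f x - y k) \<le> \<epsilon>"
        using AB[of k] k(2) by (auto simp: B_def dist_norm norm_minus_commute)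
      then have "\<bar>\<psi> x\<bar> * norm (f x - y k) \<le> \<epsilon> * \<bar>\<psi> x\<bar>"
        by (metis abs_ge_zero mult.commute mult_left_mono)
      with False show ?thesis by (simp add: s r_def)
    qed
  qed
qed

text \<open>The canonical embedding of a space into its bidual.\<close>

definition dual_eval :: "'y::real_normed_vector \<Rightarrow> ('y \<Rightarrow>\<^sub>L real) \<Rightarrow>\<^sub>L real" where
  "dual_eval v = Blinfun (\<lambda>F. blinfun_apply F v)"

lemma dual_eval_apply [simp]: "blinfun_apply (dual_eval v) F = blinfun_apply F v"
  unfolding dual_eval_def by (subst bounded_linear_Blinfun_apply) (rule blinfun.bounded_linear_left, rule refl)

lemma norm_dual_eval_le: "norm (dual_eval v) \<le> norm v"
proof (rule norm_blinfun_bound)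
  show "norm (blinfun_apply (dual_eval v) F) \<le> norm v * norm F" for F
    using norm_blinfun[of F v] by (simp add: mult.commute)
qed simp

text \<open>Elements of the bidual in general do not commute with Gelfand integrals of maps that are only
  weak* measurable. For essentially separably valued maps they do: the claim is trivial for maps with
  finitely many values, and both sides are stable under weighted \<open>L\<^sup>1\<close> approximation.\<close>

lemma bidual_commutes_with_gelfand_integral:
  fixes f :: "'a \<Rightarrow> ('y::real_normed_vector \<Rightarrow>\<^sub>L real)" and vs :: "('y \<Rightarrow>\<^sub>L real) \<Rightarrow>\<^sub>L real"
  assumes f: "f \<in> borel_measurable M"
    and N: "N \<in> null_sets M" and sep: "separable_space (top_of_set (f ` (space M - N)))"
    and \<psi>: "integrable M \<psi>" and \<psi>f: "integrable M (\<lambda>x. \<psi> x * norm (f x))"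
    and w: "\<And>v. blinfun_apply w v = (\<integral>x. \<psi> x * blinfun_apply (f x) v \<partial>M)"
  shows "blinfun_apply vs w = (\<integral>x. \<psi> x * blinfun_apply vs (f x) \<partial>M)"
proof -
  have cont_meas: "(\<lambda>x. blinfun_apply U (f x)) \<in> borel_measurable M" for U :: "('y \<Rightarrow>\<^sub>L real) \<Rightarrow>\<^sub>L real"
    using measurable_compose[OF f borel_measurable_continuous_onI[OF linear_continuous_on[OF blinfun.bounded_linear_right]]] .
  have iU: "integrable M (\<lambda>x. \<psi> x * blinfun_apply U (f x))" for U :: "('y \<Rightarrow>\<^sub>L real) \<Rightarrow>\<^sub>L real"
  proof (rule Bochner_Integration.integrable_bound[OF integrable_mult_right[OF \<psi>f, of "norm U"]])
    show "(\<lambda>x. \<psi> x * blinfun_apply U (f x)) \<in> borel_measurable M"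
      by (intro borel_measurable_times borel_measurable_integrable[OF \<psi>] cont_meas)
    show "AE x in M. norm (\<psi> x * blinfun_apply U (f x)) \<le> norm (norm U * (\<psi> x * norm (f x)))"
    proof (rule AE_I2)
      fix x
      have "\<bar>\<psi> x\<bar> * \<bar>blinfun_apply U (f x)\<bar> \<le> \<bar>\<psi> x\<bar> * (norm U * norm (f x))"
        using norm_blinfun[of U "f x"] by (intro mult_left_mono) auto
      then show "norm (\<psi> x * blinfun_apply U (f x)) \<le> norm (norm U * (\<psi> x * norm (f x)))"
        by (simp add: abs_mult mult_ac)
    qed
  qed
  have key: "\<bar>blinfun_apply vs w - (\<integral>x. \<psi> x * blinfun_apply vs (f x) \<partial>M)\<bar> \<le> 2 * norm vs * e"
    if e: "0 < e" for e
  proof -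
    obtain m :: nat and A y r where A: "\<And>k. A k \<in> sets M" "integrable M r" "(\<integral>x. r x \<partial>M) \<le> e"
      "\<And>x. x \<in> space M \<Longrightarrow> \<bar>\<psi> x\<bar> * norm (f x - (\<Sum>k<m. indicator (A k) x *\<^sub>R y k)) \<le> r x"
      by (rule weighted_simple_approximation[OF f N sep \<psi> \<psi>f e]) (rule that)
    define s where "s x = (\<Sum>k<m. indicator (A k) x *\<^sub>R y k)" for x
    define a where "a k = (\<integral>x. \<psi> x * indicator (A k) x \<partial>M)" for k
    define ws where "ws = (\<Sum>k<m. a k *\<^sub>R y k)"
    have ia: "integrable M (\<lambda>x. \<psi> x * indicator (A k) x)" for k
      using integrable_mult_indicator[OF A(1) \<psi>] by (simp add: mult.commute)
    \<comment> \<open>Both sides of the claim agree for the simple function and any functional.\<close>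
    have simple: "integrable M (\<lambda>x. \<psi> x * blinfun_apply U (s x))"
      "blinfun_apply U ws = (\<integral>x. \<psi> x * blinfun_apply U (s x) \<partial>M)" for U :: "('y \<Rightarrow>\<^sub>L real) \<Rightarrow>\<^sub>L real"
    proof -
      have e: "\<psi> x * blinfun_apply U (s x) = (\<Sum>k<m. \<psi> x * indicator (A k) x * blinfun_apply U (y k))" for x
        unfolding s_def blinfun.sum_right blinfun.scaleR_right sum_distrib_left
        by (simp only: real_scaleR_def mult.assoc)
      show "integrable M (\<lambda>x. \<psi> x * blinfun_apply U (s x))"
        unfolding e using ia by (intro Bochner_Integration.integrable_sum integrable_mult_left) auto
      show "blinfun_apply U ws = (\<integral>x. \<psi> x * blinfun_apply U (s x) \<partial>M)"
        unfolding e using ia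
        by (subst Bochner_Integration.integral_sum)
           (auto simp: ws_def a_def blinfun.sum_right blinfun.scaleR_right)
    qed
    have diff: "\<bar>(\<integral>x. \<psi> x * blinfun_apply U (f x) \<partial>M) - blinfun_apply U ws\<bar> \<le> norm U * e"
      for U :: "('y \<Rightarrow>\<^sub>L real) \<Rightarrow>\<^sub>L real"
    proof -
      have "(\<integral>x. \<psi> x * blinfun_apply U (f x) \<partial>M) - blinfun_apply U ws =
          (\<integral>x. \<psi> x * blinfun_apply U (f x) - \<psi> x * blinfun_apply U (s x) \<partial>M)"
        unfolding simple(2) by (rule Bochner_Integration.integral_diff[OF iU simple(1), symmetric])
      also have "\<bar>\<dots>\<bar> \<le> (\<integral>x. \<bar>\<psi> x * blinfun_apply U (f x) - \<psi> x * blinfun_apply U (s x)\<bar> \<partial>M)"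
        by (rule integral_abs_bound)
      also have "\<dots> \<le> (\<integral>x. norm U * r x \<partial>M)"
      proof (rule integral_mono)
        fix x assume x: "x \<in> space M"
        have "\<bar>\<psi> x * blinfun_apply U (f x) - \<psi> x * blinfun_apply U (s x)\<bar> = \<bar>\<psi> x\<bar> * \<bar>blinfun_apply U (f x - s x)\<bar>"
          by (simp add: blinfun.diff_right right_diff_distrib[symmetric] abs_mult)
        also have "\<dots> \<le> \<bar>\<psi> x\<bar> * (norm U * norm (f x - s x))"
          using norm_blinfun[of U "f x - s x"] by (intro mult_left_mono) auto
        also have "\<dots> \<le> norm U * r x"
          using mult_left_mono[OF A(4)[OF x] norm_ge_zero[of U]] by (simp add: s_def mult_ac)
        finally show "\<bar>\<psi> x * blinfun_apply U (f x) - \<psi> x * blinfun_apply U (s x)\<bar> \<le> norm U * r x" .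
      qed (use iU simple(1) A(2) in auto)
      also have "\<dots> \<le> norm U * e" using A(3) by (simp add: mult_left_mono)
      finally show ?thesis .
    qed
    have "norm (w - ws) \<le> e"
    proof (rule norm_blinfun_bound)
      fix v :: 'y
      show "norm (blinfun_apply (w - ws) v) \<le> e * norm v"
        using order_trans[OF diff[of "dual_eval v"] mult_right_mono[OF norm_dual_eval_le[of v] less_imp_le[OF e]]]
        by (simp add: w blinfun.diff_left mult.commute abs_minus_commute)
    qed (use e in simp)
    then have "\<bar>blinfun_apply vs w - blinfun_apply vs ws\<bar> \<le> norm vs * e"
      using norm_blinfun[of vs "w - ws"] mult_left_mono[of "norm (w - ws)" e "norm vs"]
      by (simp add: blinfun.diff_right)
    with diff[of vs] show ?thesis by simp
  qed
  have "\<bar>blinfun_apply vs w - (\<integral>x. \<psi> x * blinfun_apply vs (f x) \<partial>M)\<bar> \<le> 0"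
  proof (rule field_le_epsilon)
    fix e :: real assume e: "0 < e"
    have "2 * norm vs * (e / (2 * (norm vs + 1))) \<le> e"
      using e norm_ge_zero[of vs] by (simp add: field_simps add_pos_nonneg)
    then show "\<bar>blinfun_apply vs w - (\<integral>x. \<psi> x * blinfun_apply vs (f x) \<partial>M)\<bar> \<le> 0 + e"
      using key[of "e / (2 * (norm vs + 1))"] e norm_ge_zero[of vs] by (simp add: add_nonneg_pos)
  qed
  then show ?thesis by simp
qed

section \<open>Real Lebesgue spaces\<close>

lemma sigma_finite_lebesgue: "sigma_finite_measure (lebesgue :: 'a::euclidean_space measure)"
proof
  obtain A :: "'a set set" where A: "countable A" "A \<subseteq> sets lborel" "\<Union>A = space lborel" "\<forall>a\<in>A. emeasure lborel a \<noteq> \<infinity>"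
    using lborel.sigma_finite_countable by blast
  then show "\<exists>A :: 'a set set. countable A \<and> A \<subseteq> sets lebesgue \<and> \<Union>A = space lebesgue \<and> (\<forall>a\<in>A. emeasure lebesgue a \<noteq> (\<infinity>::ennreal))"
    by (intro exI[of _ A]) (auto simp: subset_eq)
qed

lemma Lp_real_dominated:
  assumes h: "h \<in> Lp_real \<Omega> p" and m: "h' \<in> borel_measurable (lebesgue_on \<Omega>)"
    and le: "\<And>x. \<bar>h' x\<bar> \<le> c * \<bar>h x\<bar>" and c: "0 \<le> c" and p: "1 \<le> p"
  shows "h' \<in> Lp_real \<Omega> p"
proof -
  have i: "integrable (lebesgue_on \<Omega>) (\<lambda>x. \<bar>h x\<bar> powr p)" using h by (simp add: Lp_real_def)
  have "integrable (lebesgue_on \<Omega>) (\<lambda>x. \<bar>h' x\<bar> powr p)"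
  proof (rule Bochner_Integration.integrable_bound[OF integrable_mult_right[OF i, of "c powr p"]])
    show "(\<lambda>x. \<bar>h' x\<bar> powr p) \<in> borel_measurable (lebesgue_on \<Omega>)" using m by measurable
    show "AE x in lebesgue_on \<Omega>. norm (\<bar>h' x\<bar> powr p) \<le> norm (c powr p * \<bar>h x\<bar> powr p)"
    proof (rule AE_I2)
      fix x
      have "\<bar>h' x\<bar> powr p \<le> (c * \<bar>h x\<bar>) powr p" using le[of x] p by (intro powr_mono2) auto
      then show "norm (\<bar>h' x\<bar> powr p) \<le> norm (c powr p * \<bar>h x\<bar> powr p)" using c by (simp add: powr_mult)
    qed
  qed
  with m show ?thesis by (simp add: Lp_real_def)
qed

lemma Lp_real_add:
  assumes f: "f \<in> Lp_real \<Omega> p" and g: "g \<in> Lp_real \<Omega> p" and p: "1 \<le> p"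
  shows "(\<lambda>x. f x + g x) \<in> Lp_real \<Omega> p"
proof -
  have m: "f \<in> borel_measurable (lebesgue_on \<Omega>)" "g \<in> borel_measurable (lebesgue_on \<Omega>)"
    and i: "integrable (lebesgue_on \<Omega>) (\<lambda>x. 2 powr p * (\<bar>f x\<bar> powr p + \<bar>g x\<bar> powr p))"
    using f g by (auto simp: Lp_real_def)
  have "integrable (lebesgue_on \<Omega>) (\<lambda>x. \<bar>f x + g x\<bar> powr p)"
  proof (rule Bochner_Integration.integrable_bound[OF i])
    show "(\<lambda>x. \<bar>f x + g x\<bar> powr p) \<in> borel_measurable (lebesgue_on \<Omega>)" using m by measurable
    show "AE x in lebesgue_on \<Omega>. norm (\<bar>f x + g x\<bar> powr p) \<le> norm (2 powr p * (\<bar>f x\<bar> powr p + \<bar>g x\<bar> powr p))"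
    proof (rule AE_I2)
      fix x
      have "\<bar>f x + g x\<bar> powr p \<le> (2 * max \<bar>f x\<bar> \<bar>g x\<bar>) powr p" using p by (intro powr_mono2) auto
      also have "\<dots> = 2 powr p * max \<bar>f x\<bar> \<bar>g x\<bar> powr p" by (simp add: powr_mult)
      also have "\<dots> \<le> 2 powr p * (\<bar>f x\<bar> powr p + \<bar>g x\<bar> powr p)"
        by (intro mult_left_mono) (auto simp: max_def)
      finally show "norm (\<bar>f x + g x\<bar> powr p) \<le> norm (2 powr p * (\<bar>f x\<bar> powr p + \<bar>g x\<bar> powr p))" by simp
    qed
  qed
  with m show ?thesis by (simp add: Lp_real_def)
qed

lemma Lp_real_sum:
  assumes "\<And>i. i \<in> I \<Longrightarrow> f i \<in> Lp_real \<Omega> p" and p: "1 \<le> p"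
  shows "(\<lambda>x. \<Sum>i\<in>I. f i x) \<in> Lp_real \<Omega> p"
  using assms(1)
proof (induction I rule: infinite_finite_induct)
  case (insert i I)
  then show ?case using Lp_real_add[OF _ _ p, of "f i" \<Omega> "\<lambda>x. \<Sum>i\<in>I. f i x"] by simp
qed (use p in \<open>auto simp: Lp_real_def\<close>)

text \<open>For \<open>p \<ge> 1\<close> one has \<open>\<bar>t\<bar> \<le> 1 + \<bar>t\<bar> powr p\<close>, and compact sets have finite measure.\<close>

lemma Lp_real_locally_integrable:
  assumes \<Omega>: "open \<Omega>" and p: "1 \<le> p" and h: "h \<in> Lp_real \<Omega> p"
  shows "locally_integrable \<Omega> h"
  unfolding locally_integrable_def
proof (intro allI impI, elim conjE)
  fix K assume K: "compact K" "K \<subseteq> \<Omega>"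
  have \<Omega>': "\<Omega> \<in> sets lebesgue" using \<Omega> by auto
  have Kl: "K \<in> lmeasurable" using K(1) by (rule lmeasurable_compact)
  have K': "K \<in> sets lebesgue" using Kl by (rule fmeasurableD)
  have m: "(\<lambda>x. indicator \<Omega> x * h x) \<in> borel_measurable lebesgue"
    using h \<Omega>' borel_measurable_restrict_space_iff[of \<Omega> lebesgue h] by (simp add: Lp_real_def)
  have i: "integrable lebesgue (\<lambda>x. indicator K x + indicator \<Omega> x * \<bar>h x\<bar> powr p)"
    using h \<Omega>' Kl K' by (intro Bochner_Integration.integrable_add integrable_real_indicator)
      (auto simp: Lp_real_def integrable_lebesgue_on_iff fmeasurable_def)
  have "integrable lebesgue (\<lambda>x. indicator K x * (indicator \<Omega> x * h x))"
  proof (rule Bochner_Integration.integrable_bound[OF i])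
    show "(\<lambda>x. indicator K x * (indicator \<Omega> x * h x)) \<in> borel_measurable lebesgue"
      using K' by (intro borel_measurable_times m borel_measurable_indicator)
    show "AE x in lebesgue. norm (indicator K x * (indicator \<Omega> x * h x)) \<le>
        norm (indicator K x + indicator \<Omega> x * \<bar>h x\<bar> powr p :: real)"
    proof (rule AE_I2)
      fix x
      have "\<bar>h x\<bar> \<le> 1 + \<bar>h x\<bar> powr p"
      proof (cases "\<bar>h x\<bar> \<le> 1")
        case False
        then have "\<bar>h x\<bar> powr 1 \<le> \<bar>h x\<bar> powr p" using p by (intro powr_mono) auto
        then show ?thesis by simp
      qed (simp add: add_increasing2)
      then show "norm (indicator K x * (indicator \<Omega> x * h x)) \<le>
        norm (indicator K x + indicator \<Omega> x * \<bar>h x\<bar> powr p :: real)"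
        using K(2) by (auto simp: indicator_def)
    qed
  qed
  also have "(\<lambda>x. indicator K x * (indicator \<Omega> x * h x)) = (\<lambda>x. indicator K x * h x)"
    using K(2) by (auto simp: indicator_def fun_eq_iff)
  finally show "integrable (lebesgue_on K) h" using K' by (simp add: integrable_lebesgue_on_iff)
qed

section \<open>Weak and weak* derivatives\<close>

lemma has_weak_gradient_linear:
  assumes \<Omega>: "open \<Omega>" and G: "has_weak_gradient h G \<Omega>" and G': "has_weak_gradient h' G' \<Omega>"
  shows "has_weak_gradient (\<lambda>x. a * h x + b * h' x) (\<lambda>x. a *\<^sub>R G x + b *\<^sub>R G' x) \<Omega>"
proof -
  have l: "locally_integrable \<Omega> (\<lambda>x. a * u x + b * u' x)"
    if "locally_integrable \<Omega> u" "locally_integrable \<Omega> u'" for u u' :: "real^'a \<Rightarrow> real"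
    using that unfolding locally_integrable_def by auto
  have hl: "locally_integrable \<Omega> h" "locally_integrable \<Omega> h'"
    and Gl: "locally_integrable \<Omega> (\<lambda>x. G x $ j)" "locally_integrable \<Omega> (\<lambda>x. G' x $ j)" for j
    using G G' by (auto simp: has_weak_gradient_def)
  have "(\<integral>x. partial_deriv j \<phi> x * (a * h x + b * h' x) \<partial>lebesgue_on \<Omega>) =
      - (\<integral>x. \<phi> x * (a * G x $ j + b * G' x $ j) \<partial>lebesgue_on \<Omega>)"
    if \<phi>: "\<phi> \<in> test_functions \<Omega>" for \<phi> j
  proof -
    have lin: "(\<integral>x. \<psi> x * (a * u x + b * u' x) \<partial>lebesgue_on \<Omega>) =
       a * (\<integral>x. \<psi> x * u x \<partial>lebesgue_on \<Omega>) + b * (\<integral>x. \<psi> x * u' x \<partial>lebesgue_on \<Omega>)"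
      if "integrable (lebesgue_on \<Omega>) (\<lambda>x. \<psi> x * u x)" "integrable (lebesgue_on \<Omega>) (\<lambda>x. \<psi> x * u' x)"
      for \<psi> u u' :: "real^'a \<Rightarrow> real"
      using that by (simp add: distrib_left mult.left_commute)
    have "(\<integral>x. partial_deriv j \<phi> x * h x \<partial>lebesgue_on \<Omega>) = - (\<integral>x. \<phi> x * G x $ j \<partial>lebesgue_on \<Omega>)"
      "(\<integral>x. partial_deriv j \<phi> x * h' x \<partial>lebesgue_on \<Omega>) = - (\<integral>x. \<phi> x * G' x $ j \<partial>lebesgue_on \<Omega>)"
      using G G' \<phi> by (auto simp: has_weak_gradient_def)
    then show ?thesis
      unfolding lin[OF test_function_integrable(2)[OF \<Omega> hl(1) \<phi>] test_function_integrable(2)[OF \<Omega> hl(2) \<phi>]]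
        lin[OF test_function_integrable(1)[OF \<Omega> Gl(1) \<phi>] test_function_integrable(1)[OF \<Omega> Gl(2) \<phi>]]
      by simp
  qed
  then show ?thesis using l[OF hl] l[OF Gl] by (simp add: has_weak_gradient_def)
qed

text \<open>The weak* derivative \<open>fj\<close> cannot be composed with an element \<open>vs\<close> of the bidual: the result
  need not be measurable. Instead \<open>vs\<close> is applied to the Gelfand integrals of \<open>\<psi> fj\<close>. This is a
  linear functional of \<open>\<psi>\<close>, bounded by \<open>norm vs\<close> in \<open>L\<^sup>1\<close> with weight \<open>norm fj\<close>, so it has a
  density \<open>h\<close>. For a test function \<open>\<phi>\<close> the integral of \<open>\<phi> fj\<close> is minus that of \<open>\<partial>\<^sub>j\<phi> f\<close>, and
  \<open>vs\<close> may be moved inside the latter since \<open>f\<close> is essentially separably valued.\<close>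

lemma gelfand_derivative_pairing_density:
  fixes f fj :: "real^'n::finite \<Rightarrow> ('y::real_normed_vector \<Rightarrow>\<^sub>L real)" and vs :: "('y \<Rightarrow>\<^sub>L real) \<Rightarrow>\<^sub>L real"
  assumes \<Omega>: "open \<Omega>" and p: "1 \<le> p" and f: "f \<in> Lp \<Omega> p" and fj: "fj \<in> Lp_star \<Omega> p"
    and parts: "\<And>\<phi>. \<phi> \<in> test_functions \<Omega> \<Longrightarrow> \<exists>I J.
        has_gelfand_integral (\<lambda>x. partial_deriv j \<phi> x *\<^sub>R f x) I \<Omega> \<and>
        has_gelfand_integral (\<lambda>x. \<phi> x *\<^sub>R fj x) J \<Omega> \<and> I = - J"
  obtains h where "h \<in> borel_measurable (lebesgue_on \<Omega>)" "\<And>x. \<bar>h x\<bar> \<le> norm vs * norm (fj x)"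
    "\<And>\<phi>. \<phi> \<in> test_functions \<Omega> \<Longrightarrow>
      (\<integral>x. partial_deriv j \<phi> x * blinfun_apply vs (f x) \<partial>lebesgue_on \<Omega>) = - (\<integral>x. \<phi> x * h x \<partial>lebesgue_on \<Omega>)"
proof -
  define M where "M = lebesgue_on \<Omega>"
  have \<Omega>': "\<Omega> \<in> sets lebesgue" using \<Omega> by auto
  have sf: "sigma_finite_measure M"
    unfolding M_def by (rule sigma_finite_measure_restrict_space[OF sigma_finite_lebesgue \<Omega>'])
  have fjm: "(\<lambda>x. blinfun_apply (fj x) v) \<in> borel_measurable M" for v
    using fj by (simp add: Lp_star_def weak_star_measurable_def M_def)
  have gL: "(\<lambda>x. norm (fj x)) \<in> Lp_real \<Omega> p" using fj by (simp add: Lp_star_def)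
  then have gm: "(\<lambda>x. norm (fj x)) \<in> borel_measurable M" by (simp add: Lp_real_def M_def)
  define is_W where "is_W \<psi> w \<longleftrightarrow> (\<forall>v. integrable M (\<lambda>x. \<psi> x * blinfun_apply (fj x) v)) \<and>
        (\<forall>v. blinfun_apply w v = (\<integral>x. \<psi> x * blinfun_apply (fj x) v \<partial>M)) \<and>
        norm w \<le> (\<integral>x. \<bar>\<psi> x\<bar> * norm (fj x) \<partial>M)" for \<psi> w
  define W where "W \<psi> = (SOME w. is_W \<psi> w)" for \<psi>
  have "is_W \<psi> (W \<psi>)"
    if \<psi>: "\<psi> \<in> borel_measurable M" "integrable M (\<lambda>x. \<psi> x * norm (fj x))" for \<psi>
  proof -
    obtain w where "\<And>v. integrable M (\<lambda>x. \<psi> x * blinfun_apply (fj x) v)"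
      "\<And>v. blinfun_apply w v = (\<integral>x. \<psi> x * blinfun_apply (fj x) v \<partial>M)"
      "norm w \<le> (\<integral>x. \<bar>\<psi> x\<bar> * norm (fj x) \<partial>M)"
      by (rule gelfand_integral_exists[OF fjm \<psi>]) (rule that)
    then have "is_W \<psi> w" by (simp add: is_W_def)
    then show ?thesis unfolding W_def by (rule someI)
  qed
  then have W: "\<And>\<psi> v. \<psi> \<in> borel_measurable M \<Longrightarrow> integrable M (\<lambda>x. \<psi> x * norm (fj x)) \<Longrightarrow>
        integrable M (\<lambda>x. \<psi> x * blinfun_apply (fj x) v)"
      "\<And>\<psi> v. \<psi> \<in> borel_measurable M \<Longrightarrow> integrable M (\<lambda>x. \<psi> x * norm (fj x)) \<Longrightarrow>
        blinfun_apply (W \<psi>) v = (\<integral>x. \<psi> x * blinfun_apply (fj x) v \<partial>M)"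
      "\<And>\<psi>. \<psi> \<in> borel_measurable M \<Longrightarrow> integrable M (\<lambda>x. \<psi> x * norm (fj x)) \<Longrightarrow>
        norm (W \<psi>) \<le> (\<integral>x. \<bar>\<psi> x\<bar> * norm (fj x) \<partial>M)"
    by (simp_all add: is_W_def)
  have "\<exists>h\<in>borel_measurable M. (\<forall>x. \<bar>h x\<bar> \<le> norm vs * norm (fj x)) \<and>
    (\<forall>\<psi>. \<psi> \<in> borel_measurable M \<and> integrable M (\<lambda>x. \<psi> x * norm (fj x)) \<longrightarrow>
       blinfun_apply vs (W \<psi>) = (\<integral>x. \<psi> x * h x \<partial>M))"
  proof (rule weighted_L1_functional_density[OF sf gm norm_ge_zero])
    fix \<phi> \<psi> :: "real^'n \<Rightarrow> real"
    assume a: "\<phi> \<in> borel_measurable M" "integrable M (\<lambda>x. \<phi> x * norm (fj x))"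
      "\<psi> \<in> borel_measurable M" "integrable M (\<lambda>x. \<psi> x * norm (fj x))"
    have s: "(\<lambda>x. \<phi> x + \<psi> x) \<in> borel_measurable M" "integrable M (\<lambda>x. (\<phi> x + \<psi> x) * norm (fj x))"
      using a by (auto simp: distrib_right)
    have "W (\<lambda>x. \<phi> x + \<psi> x) = W \<phi> + W \<psi>"
      using W(1)[OF a(1,2)] W(1)[OF a(3,4)]
      by (intro blinfun_eqI) (simp add: W(2)[OF s] W(2)[OF a(1,2)] W(2)[OF a(3,4)] blinfun.add_left distrib_right)
    then show "blinfun_apply vs (W (\<lambda>x. \<phi> x + \<psi> x)) = blinfun_apply vs (W \<phi>) + blinfun_apply vs (W \<psi>)"
      by (simp add: blinfun.add_right)
  next
    fix c :: real and \<phi> :: "real^'n \<Rightarrow> real"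
    assume a: "\<phi> \<in> borel_measurable M" "integrable M (\<lambda>x. \<phi> x * norm (fj x))"
    have s: "(\<lambda>x. c * \<phi> x) \<in> borel_measurable M" "integrable M (\<lambda>x. (c * \<phi> x) * norm (fj x))"
      using a by (auto simp: mult.assoc)
    have "W (\<lambda>x. c * \<phi> x) = c *\<^sub>R W \<phi>"
      by (intro blinfun_eqI) (simp add: W(2)[OF s] W(2)[OF a] blinfun.scaleR_left mult.assoc)
    then show "blinfun_apply vs (W (\<lambda>x. c * \<phi> x)) = c * blinfun_apply vs (W \<phi>)"
      by (simp add: blinfun.scaleR_right)
  next
    fix \<phi> :: "real^'n \<Rightarrow> real"
    assume a: "\<phi> \<in> borel_measurable M" "integrable M (\<lambda>x. \<phi> x * norm (fj x))"
    show "\<bar>blinfun_apply vs (W \<phi>)\<bar> \<le> norm vs * (\<integral>x. \<bar>\<phi> x\<bar> * norm (fj x) \<partial>M)"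
      using norm_blinfun[of vs "W \<phi>"] mult_left_mono[OF W(3)[OF a] norm_ge_zero[of vs]] by simp
  qed simp
  then obtain h where h: "h \<in> borel_measurable M" "\<And>x. \<bar>h x\<bar> \<le> norm vs * norm (fj x)"
    "\<And>\<psi>. \<psi> \<in> borel_measurable M \<Longrightarrow> integrable M (\<lambda>x. \<psi> x * norm (fj x)) \<Longrightarrow>
       blinfun_apply vs (W \<psi>) = (\<integral>x. \<psi> x * h x \<partial>M)" by blast
  show thesis
  proof (rule that[OF h(1)[unfolded M_def] h(2)])
    fix \<phi> assume \<phi>: "\<phi> \<in> test_functions \<Omega>"
    obtain K where K: "compact K" "K \<subseteq> \<Omega>" "continuous_on UNIV \<phi>" "\<And>x. x \<notin> K \<Longrightarrow> \<phi> x = 0"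
      "\<And>j. continuous_on UNIV (partial_deriv j \<phi>)" "\<And>j x. x \<notin> K \<Longrightarrow> partial_deriv j \<phi> x = 0"
      by (rule test_function_support[OF \<phi>]) (rule that)
    have \<phi>m: "\<phi> \<in> borel_measurable M"
      unfolding M_def using continuous_imp_lebesgue_measurable[OF K(3)] by (rule measurable_restrict_space1)
    have \<phi>i: "integrable M (\<lambda>x. \<phi> x * norm (fj x))"
      unfolding M_def by (rule test_function_integrable(1)[OF \<Omega> Lp_real_locally_integrable[OF \<Omega> p gL] \<phi>])
    obtain I J where IJ: "has_gelfand_integral (\<lambda>x. partial_deriv j \<phi> x *\<^sub>R f x) I \<Omega>"
        "has_gelfand_integral (\<lambda>x. \<phi> x *\<^sub>R fj x) J \<Omega>" "I = - J" using parts[OF \<phi>] by blast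
    have J: "J = W \<phi>"
      using IJ(2) by (intro blinfun_eqI)
        (simp add: W(2)[OF \<phi>m \<phi>i] has_gelfand_integral_def blinfun.scaleR_left M_def)
    have fm: "f \<in> borel_measurable (lebesgue_on \<Omega>)" and fL: "(\<lambda>x. norm (f x)) \<in> Lp_real \<Omega> p"
      using f by (auto simp: Lp_def)
    obtain N where N: "N \<in> null_sets (lebesgue_on \<Omega>)" "separable_space (top_of_set (f ` (\<Omega> - N)))"
      using f by (auto simp: Lp_def essentially_separably_valued_def)
    have one: "locally_integrable \<Omega> (\<lambda>x. 1)"
      unfolding locally_integrable_def
    proof (intro allI impI, elim conjE)
      fix K :: "(real^'n) set" assume "compact K"
      then have "K \<in> lmeasurable" by (rule lmeasurable_compact)
      then have K: "K \<in> sets lebesgue" "emeasure lebesgue K < \<infinity>" by (auto simp: fmeasurable_def)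
      show "integrable (lebesgue_on K) (\<lambda>x. 1 :: real)"
        unfolding integrable_lebesgue_on_iff[OF K(1)] mult_1_right by (rule integrable_real_indicator[OF K])
    qed
    have I1: "blinfun_apply I v = (\<integral>x. partial_deriv j \<phi> x * blinfun_apply (f x) v \<partial>lebesgue_on \<Omega>)" for v
      using IJ(1) by (simp add: has_gelfand_integral_def blinfun.scaleR_left)
    have I2: "integrable (lebesgue_on \<Omega>) (\<lambda>x. partial_deriv j \<phi> x * norm (f x))"
      by (rule test_function_integrable(2)[OF \<Omega> Lp_real_locally_integrable[OF \<Omega> p fL] \<phi>])
    have "blinfun_apply vs I = (\<integral>x. partial_deriv j \<phi> x * blinfun_apply vs (f x) \<partial>lebesgue_on \<Omega>)"
    proof (rule bidual_commutes_with_gelfand_integral[OF fm N(1) _ _ I2 I1])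
      show "separable_space (top_of_set (f ` (space (lebesgue_on \<Omega>) - N)))" using N(2) unfolding space_lebesgue_on .
      show "integrable (lebesgue_on \<Omega>) (partial_deriv j \<phi>)"
        using test_function_integrable(2)[OF \<Omega> one \<phi>, of j] unfolding mult_1_right .
    qed
    then have "(\<integral>x. partial_deriv j \<phi> x * blinfun_apply vs (f x) \<partial>lebesgue_on \<Omega>) = blinfun_apply vs (- W \<phi>)"
      unfolding IJ(3) J by (rule sym)
    also have "\<dots> = - (\<integral>x. \<phi> x * h x \<partial>lebesgue_on \<Omega>)"
      unfolding blinfun.minus_right h(3)[OF \<phi>m \<phi>i] M_def by (rule refl)
    finally show "(\<integral>x. partial_deriv j \<phi> x * blinfun_apply vs (f x) \<partial>lebesgue_on \<Omega>) = - (\<integral>x. \<phi> x * h x \<partial>lebesgue_on \<Omega>)" .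
  qed
qed

text \<open>The densities of the functionals above are the weak partial derivatives of the pairings. Their common
  majorant is the sum of the norms of the weak* partial derivatives, which dominates the Euclidean norm
  of the gradient.\<close>

lemma sobolev_W1p_star_subset_reshetnyak:
  fixes \<Omega> :: "(real^'n::finite) set"
  assumes \<Omega>: "open \<Omega>" and p: "1 \<le> p"
  shows "(sobolev_W1p_star \<Omega> p :: (real^'n \<Rightarrow> ('y::real_normed_vector \<Rightarrow>\<^sub>L real)) set)
    \<subseteq> reshetnyak_sobolev_R1p \<Omega> p"
proof
  fix f :: "real^'n \<Rightarrow> ('y \<Rightarrow>\<^sub>L real)"
  assume f: "f \<in> sobolev_W1p_star \<Omega> p"
  then have fL: "f \<in> Lp \<Omega> p" by (simp add: sobolev_W1p_star_def)
  have "\<forall>j. \<exists>fj. fj \<in> Lp_star \<Omega> p \<and> (\<forall>\<phi>\<in>test_functions \<Omega>. \<exists>I J.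
        has_gelfand_integral (\<lambda>x. partial_deriv j \<phi> x *\<^sub>R f x) I \<Omega> \<and>
        has_gelfand_integral (\<lambda>x. \<phi> x *\<^sub>R fj x) J \<Omega> \<and> I = - J)"
    using f unfolding sobolev_W1p_star_def mem_Collect_eq Bex_def by (rule conjunct2)
  from choice[OF this] obtain D where D': "\<forall>j. D j \<in> Lp_star \<Omega> p \<and> (\<forall>\<phi>\<in>test_functions \<Omega>. \<exists>I J.
        has_gelfand_integral (\<lambda>x. partial_deriv j \<phi> x *\<^sub>R f x) I \<Omega> \<and>
        has_gelfand_integral (\<lambda>x. \<phi> x *\<^sub>R D j x) J \<Omega> \<and> I = - J)" ..
  have D: "D j \<in> Lp_star \<Omega> p"
    "\<phi> \<in> test_functions \<Omega> \<Longrightarrow> \<exists>I J.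
        has_gelfand_integral (\<lambda>x. partial_deriv j \<phi> x *\<^sub>R f x) I \<Omega> \<and>
        has_gelfand_integral (\<lambda>x. \<phi> x *\<^sub>R D j x) J \<Omega> \<and> I = - J" for j \<phi>
    using D'[rule_format, of j] by auto
  have DL: "(\<lambda>x. norm (D j x)) \<in> Lp_real \<Omega> p" for j using D(1)[of j] by (simp add: Lp_star_def)
  have pairing: "(\<lambda>x. blinfun_apply vs (f x)) \<in> Lp_real \<Omega> p" for vs :: "('y \<Rightarrow>\<^sub>L real) \<Rightarrow>\<^sub>L real"
  proof (rule Lp_real_dominated[of "\<lambda>x. norm (f x)"])
    show "(\<lambda>x. norm (f x)) \<in> Lp_real \<Omega> p" using fL by (simp add: Lp_def)
    have "f \<in> borel_measurable (lebesgue_on \<Omega>)" using fL by (simp add: Lp_def)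
    from measurable_compose[OF this borel_measurable_continuous_onI[OF linear_continuous_on[OF blinfun.bounded_linear_right]]]
    show "(\<lambda>x. blinfun_apply vs (f x)) \<in> borel_measurable (lebesgue_on \<Omega>)" .
    show "\<bar>blinfun_apply vs (f x)\<bar> \<le> norm vs * \<bar>norm (f x)\<bar>" for x
      using norm_blinfun[of vs "f x"] by simp
  qed (use p in auto)
  have ex: "\<exists>G. has_weak_gradient (\<lambda>x. blinfun_apply vs (f x)) G \<Omega> \<and>
      (\<forall>j. (\<lambda>x. G x $ j) \<in> Lp_real \<Omega> p) \<and> (\<forall>j x. \<bar>G x $ j\<bar> \<le> norm vs * norm (D j x))"
    for vs :: "('y \<Rightarrow>\<^sub>L real) \<Rightarrow>\<^sub>L real"
  proof -
    have "\<forall>j. \<exists>h. h \<in> borel_measurable (lebesgue_on \<Omega>) \<and> (\<forall>x. \<bar>h x\<bar> \<le> norm vs * norm (D j x)) \<and>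
      (\<forall>\<phi>\<in>test_functions \<Omega>. (\<integral>x. partial_deriv j \<phi> x * blinfun_apply vs (f x) \<partial>lebesgue_on \<Omega>) =
        - (\<integral>x. \<phi> x * h x \<partial>lebesgue_on \<Omega>))"
    proof
      fix j
      show "\<exists>h. h \<in> borel_measurable (lebesgue_on \<Omega>) \<and> (\<forall>x. \<bar>h x\<bar> \<le> norm vs * norm (D j x)) \<and>
      (\<forall>\<phi>\<in>test_functions \<Omega>. (\<integral>x. partial_deriv j \<phi> x * blinfun_apply vs (f x) \<partial>lebesgue_on \<Omega>) =
        - (\<integral>x. \<phi> x * h x \<partial>lebesgue_on \<Omega>))"
        by (rule gelfand_derivative_pairing_density[OF \<Omega> p fL D(1)[of j] D(2)[of _ j], of vs]) auto
    qed
    from choice[OF this] obtain H where H': "\<forall>j. H j \<in> borel_measurable (lebesgue_on \<Omega>) \<and> (\<forall>x. \<bar>H j x\<bar> \<le> norm vs * norm (D j x)) \<and>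
      (\<forall>\<phi>\<in>test_functions \<Omega>. (\<integral>x. partial_deriv j \<phi> x * blinfun_apply vs (f x) \<partial>lebesgue_on \<Omega>) =
        - (\<integral>x. \<phi> x * H j x \<partial>lebesgue_on \<Omega>))" ..
    have H: "H j \<in> borel_measurable (lebesgue_on \<Omega>)"
      "\<bar>H j x\<bar> \<le> norm vs * norm (D j x)"
      "\<phi> \<in> test_functions \<Omega> \<Longrightarrow> (\<integral>x. partial_deriv j \<phi> x * blinfun_apply vs (f x) \<partial>lebesgue_on \<Omega>) =
        - (\<integral>x. \<phi> x * H j x \<partial>lebesgue_on \<Omega>)" for j x \<phi>
      using H'[rule_format, of j] by auto
    have HL: "H j \<in> Lp_real \<Omega> p" for j
      by (rule Lp_real_dominated[OF DL[of j] H(1), where c = "norm vs"]) (use H(2) p in auto)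
    define G where "G x = (\<chi> j. H j x)" for x
    have "has_weak_gradient (\<lambda>x. blinfun_apply vs (f x)) G \<Omega>"
      unfolding has_weak_gradient_def G_def
      using Lp_real_locally_integrable[OF \<Omega> p pairing] Lp_real_locally_integrable[OF \<Omega> p HL] H(3) by simp
    with HL H(2) show ?thesis by (intro exI[of _ G]) (simp add: G_def)
  qed
  have sumL: "(\<lambda>x. \<Sum>j\<in>UNIV. norm (D j x)) \<in> Lp_real \<Omega> p"
    by (rule Lp_real_sum[OF DL p])
  have R: "(\<lambda>x. blinfun_apply vs (f x)) \<in> sobolev_W1p \<Omega> p"
    "\<exists>G. has_weak_gradient (\<lambda>x. blinfun_apply vs (f x)) G \<Omega> \<and>
       (AE x in lebesgue_on \<Omega>. norm (G x) \<le> norm vs * (\<Sum>j\<in>UNIV. norm (D j x)))"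
    for vs :: "('y \<Rightarrow>\<^sub>L real) \<Rightarrow>\<^sub>L real"
  proof -
    obtain G where G: "has_weak_gradient (\<lambda>x. blinfun_apply vs (f x)) G \<Omega>"
      "\<forall>j. (\<lambda>x. G x $ j) \<in> Lp_real \<Omega> p" "\<forall>j x. \<bar>G x $ j\<bar> \<le> norm vs * norm (D j x)"
      using ex[of vs] by blast
    show "(\<lambda>x. blinfun_apply vs (f x)) \<in> sobolev_W1p \<Omega> p"
      using G(1,2) pairing[of vs] by (auto simp: sobolev_W1p_def)
    have "norm (G x) \<le> norm vs * (\<Sum>j\<in>UNIV. norm (D j x))" for x
    proof -
      have "norm (G x) \<le> (\<Sum>j\<in>UNIV. \<bar>G x $ j\<bar>)" by (rule norm_le_l1_cart)
      also have "\<dots> \<le> (\<Sum>j\<in>UNIV. norm vs * norm (D j x))" using G(3) by (intro sum_mono) auto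
      finally show ?thesis by (simp add: sum_distrib_left)
    qed
    with G(1) show "\<exists>G. has_weak_gradient (\<lambda>x. blinfun_apply vs (f x)) G \<Omega> \<and>
       (AE x in lebesgue_on \<Omega>. norm (G x) \<le> norm vs * (\<Sum>j\<in>UNIV. norm (D j x)))"
      by (intro exI[of _ G]) auto
  qed
  show "f \<in> reshetnyak_sobolev_R1p \<Omega> p"
    unfolding reshetnyak_sobolev_R1p_def mem_Collect_eq
    by (intro conjI allI bexI[OF _ sumL] fL R)
qed

text \<open>The evaluations at vectors of the predual belong to the bidual. Their weak partial
  derivatives depend linearly on the vector by uniqueness of weak gradients, and are bounded by
  \<open>norm v * \<bar>g x\<bar>\<close>; the absolute value is there because \<open>g\<close> may be negative on a null set, and anywhere
  if the predual is trivial. The selection lemma turns them into a weak* derivative.\<close>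

lemma reshetnyak_subset_sobolev_W1p_star:
  fixes \<Omega> :: "(real^'n::finite) set"
  assumes \<Omega>: "open \<Omega>" and sep: "separable_space (euclidean :: 'y::real_normed_vector topology)" and p: "1 \<le> p"
  shows "(reshetnyak_sobolev_R1p \<Omega> p :: (real^'n \<Rightarrow> ('y \<Rightarrow>\<^sub>L real)) set) \<subseteq> sobolev_W1p_star \<Omega> p"
proof
  fix f :: "real^'n \<Rightarrow> ('y \<Rightarrow>\<^sub>L real)"
  assume f: "f \<in> reshetnyak_sobolev_R1p \<Omega> p"
  then have fL: "f \<in> Lp \<Omega> p" by (simp add: reshetnyak_sobolev_R1p_def)
  then have fnL: "(\<lambda>x. norm (f x)) \<in> Lp_real \<Omega> p" by (simp add: Lp_def)
  obtain g where g: "g \<in> Lp_real \<Omega> p"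
    "\<And>vs. \<exists>G. has_weak_gradient (\<lambda>x. blinfun_apply vs (f x)) G \<Omega> \<and>
          (AE x in lebesgue_on \<Omega>. norm (G x) \<le> norm vs * g x)"
    using f unfolding reshetnyak_sobolev_R1p_def by blast
  have "\<forall>v. \<exists>G. has_weak_gradient (\<lambda>x. blinfun_apply (f x) v) G \<Omega> \<and> (\<forall>j. (\<lambda>x. G x $ j) \<in> Lp_real \<Omega> p)"
  proof
    fix v
    have "(\<lambda>x. blinfun_apply (dual_eval v) (f x)) \<in> sobolev_W1p \<Omega> p"
      using f unfolding reshetnyak_sobolev_R1p_def by blast
    then show "\<exists>G. has_weak_gradient (\<lambda>x. blinfun_apply (f x) v) G \<Omega> \<and> (\<forall>j. (\<lambda>x. G x $ j) \<in> Lp_real \<Omega> p)"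
      by (simp add: sobolev_W1p_def)
  qed
  from choice[OF this] obtain G where
    G': "\<forall>v. has_weak_gradient (\<lambda>x. blinfun_apply (f x) v) (G v) \<Omega> \<and> (\<forall>j. (\<lambda>x. G v x $ j) \<in> Lp_real \<Omega> p)" ..
  have G: "has_weak_gradient (\<lambda>x. blinfun_apply (f x) v) (G v) \<Omega>"
    "(\<lambda>x. G v x $ j) \<in> Lp_real \<Omega> p" for v j
    using G'[rule_format, of v] by auto
  have G_add: "AE x in lebesgue_on \<Omega>. G (v + w) x $ j = G v x $ j + G w x $ j" for v w j
    using weak_gradient_unique[OF \<Omega> G(1)[of "v + w"], of "\<lambda>x. 1 *\<^sub>R G v x + 1 *\<^sub>R G w x" j]
      has_weak_gradient_linear[OF \<Omega> G(1)[of v] G(1)[of w], of 1 1]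
    by (simp add: blinfun.add_right)
  have G_scale: "AE x in lebesgue_on \<Omega>. G (c *\<^sub>R v) x $ j = c * G v x $ j" for c v j
    using weak_gradient_unique[OF \<Omega> G(1)[of "c *\<^sub>R v"], of "\<lambda>x. c *\<^sub>R G v x + 0 *\<^sub>R G v x" j]
      has_weak_gradient_linear[OF \<Omega> G(1)[of v] G(1)[of v], of c 0]
    by (simp add: blinfun.scaleR_right)
  have G_bound: "AE x in lebesgue_on \<Omega>. \<bar>G v x $ j\<bar> \<le> norm v * \<bar>g x\<bar>" for v j
  proof -
    obtain G' where G': "has_weak_gradient (\<lambda>x. blinfun_apply (f x) v) G' \<Omega>"
      "AE x in lebesgue_on \<Omega>. norm (G' x) \<le> norm (dual_eval v) * g x"
      using g(2)[of "dual_eval v"] by auto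
    from weak_gradient_unique[OF \<Omega> G(1)[of v] G'(1), of j] G'(2) show ?thesis
    proof eventually_elim
      case (elim x)
      have "\<bar>G v x $ j\<bar> \<le> norm (dual_eval v) * g x"
        using elim component_le_norm_cart[of "G' x" j] by simp
      also have "\<dots> \<le> norm v * \<bar>g x\<bar>"
        using mult_left_mono[OF abs_ge_self[of "g x"] norm_ge_zero[of "dual_eval v"]]
          mult_right_mono[OF norm_dual_eval_le[of v] abs_ge_zero[of "g x"]] by linarith
      finally show ?case .
    qed
  qed
  have "\<exists>fj\<in>Lp_star \<Omega> p. \<forall>\<phi>\<in>test_functions \<Omega>. \<exists>I J.
        has_gelfand_integral (\<lambda>x. partial_deriv j \<phi> x *\<^sub>R f x) I \<Omega> \<and>
        has_gelfand_integral (\<lambda>x. \<phi> x *\<^sub>R fj x) J \<Omega> \<and> I = - J" for j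
  proof -
    have Gm: "(\<lambda>x. G v x $ j) \<in> borel_measurable (lebesgue_on \<Omega>)" for v
      using G(2)[of v j] by (simp add: Lp_real_def)
    obtain fj where fj: "\<And>v. (\<lambda>x. blinfun_apply (fj x) v) \<in> borel_measurable (lebesgue_on \<Omega>)"
      "\<And>v. AE x in lebesgue_on \<Omega>. blinfun_apply (fj x) v = G v x $ j" "\<And>x. norm (fj x) \<le> \<bar>\<bar>g x\<bar>\<bar>"
      by (rule weak_star_density_selection[OF sep Gm G_add G_scale G_bound]) (rule that)
    have fjn: "(\<lambda>x. norm (fj x)) \<in> Lp_real \<Omega> p"
      by (rule Lp_real_dominated[OF g(1) norm_weak_star_measurable[OF sep fj(1)], of 1]) (use fj(3) p in auto)
    have fjL: "fj \<in> Lp_star \<Omega> p"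
      using fjn fj(1) by (simp add: Lp_star_def weak_star_measurable_def)
    have gelf: "\<exists>I. has_gelfand_integral (\<lambda>x. \<psi> x *\<^sub>R F x) I \<Omega>"
      if F\<psi>: "\<psi> \<in> borel_measurable (lebesgue_on \<Omega>)" "integrable (lebesgue_on \<Omega>) (\<lambda>x. \<psi> x * norm (F x))"
        "\<And>v. (\<lambda>x. blinfun_apply (F x) v) \<in> borel_measurable (lebesgue_on \<Omega>)"
      for \<psi> and F :: "real^'n \<Rightarrow> ('y \<Rightarrow>\<^sub>L real)"
    proof -
      obtain w where "\<And>v. integrable (lebesgue_on \<Omega>) (\<lambda>x. \<psi> x * blinfun_apply (F x) v)"
        "\<And>v. blinfun_apply w v = (\<integral>x. \<psi> x * blinfun_apply (F x) v \<partial>lebesgue_on \<Omega>)"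
        by (rule gelfand_integral_exists[OF F\<psi>(3,1,2)]) (rule that)
      moreover from this have "(\<lambda>x. \<psi> x * blinfun_apply (F x) v) \<in> borel_measurable (lebesgue_on \<Omega>)" for v
        by (intro borel_measurable_integrable)
      ultimately show ?thesis
        by (intro exI[of _ w]) (simp add: has_gelfand_integral_def weak_star_measurable_def blinfun.scaleR_left)
    qed
    have fm: "(\<lambda>x. blinfun_apply (f x) v) \<in> borel_measurable (lebesgue_on \<Omega>)" for v
    proof -
      have "f \<in> borel_measurable (lebesgue_on \<Omega>)" using fL by (simp add: Lp_def)
      from measurable_compose[OF this borel_measurable_continuous_onI[OF linear_continuous_on[OF blinfun.bounded_linear_left]]]
      show ?thesis .
    qed
    show ?thesis
    proof (intro bexI[OF _ fjL] ballI)
      fix \<phi> assume \<phi>: "\<phi> \<in> test_functions \<Omega>"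
      obtain K where K: "compact K" "K \<subseteq> \<Omega>" "continuous_on UNIV \<phi>" "\<And>x. x \<notin> K \<Longrightarrow> \<phi> x = 0"
        "\<And>j. continuous_on UNIV (partial_deriv j \<phi>)" "\<And>j x. x \<notin> K \<Longrightarrow> partial_deriv j \<phi> x = 0"
        by (rule test_function_support[OF \<phi>]) (rule that)
      obtain I where I: "has_gelfand_integral (\<lambda>x. partial_deriv j \<phi> x *\<^sub>R f x) I \<Omega>"
        using gelf[OF measurable_restrict_space1[OF continuous_imp_lebesgue_measurable[OF K(5)]]
          test_function_integrable(2)[OF \<Omega> Lp_real_locally_integrable[OF \<Omega> p fnL] \<phi>] fm] by blast
      obtain J where J: "has_gelfand_integral (\<lambda>x. \<phi> x *\<^sub>R fj x) J \<Omega>"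
        using gelf[OF measurable_restrict_space1[OF continuous_imp_lebesgue_measurable[OF K(3)]]
          test_function_integrable(1)[OF \<Omega> Lp_real_locally_integrable[OF \<Omega> p fjn] \<phi>] fj(1)] by blast
      have "blinfun_apply I v = blinfun_apply (- J) v" for v
      proof -
        have "blinfun_apply I v = (\<integral>x. partial_deriv j \<phi> x * blinfun_apply (f x) v \<partial>lebesgue_on \<Omega>)"
          using I by (simp add: has_gelfand_integral_def blinfun.scaleR_left)
        also have "\<dots> = - (\<integral>x. \<phi> x * G v x $ j \<partial>lebesgue_on \<Omega>)"
          using G(1)[of v] \<phi> by (simp add: has_weak_gradient_def)
        also have "(\<integral>x. \<phi> x * G v x $ j \<partial>lebesgue_on \<Omega>) = (\<integral>x. \<phi> x * blinfun_apply (fj x) v \<partial>lebesgue_on \<Omega>)"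
        proof (rule integral_cong_AE)
          show "AE x in lebesgue_on \<Omega>. \<phi> x * G v x $ j = \<phi> x * blinfun_apply (fj x) v"
            using fj(2)[of v] by eventually_elim simp
        qed (intro borel_measurable_times Gm fj(1)
            measurable_restrict_space1[OF continuous_imp_lebesgue_measurable[OF K(3)]])+
        also have "\<dots> = blinfun_apply J v"
          using J by (simp add: has_gelfand_integral_def blinfun.scaleR_left)
        finally show ?thesis by (simp add: blinfun.minus_left)
      qed
      then have "I = - J" by (rule blinfun_eqI)
      with I J show "\<exists>I J. has_gelfand_integral (\<lambda>x. partial_deriv j \<phi> x *\<^sub>R f x) I \<Omega> \<and>
        has_gelfand_integral (\<lambda>x. \<phi> x *\<^sub>R fj x) J \<Omega> \<and> I = - J" by blast
    qed
  qed
  with fL show "f \<in> sobolev_W1p_star \<Omega> p" by (simp add: sobolev_W1p_star_def)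
qed

theorem theorem1p4:
  fixes \<Omega> :: "(real^'n) set" and p :: real
  assumes "open \<Omega>"
    and "separable_space (euclidean :: 'y::banach topology)"
    and "1 \<le> p"
  shows "(sobolev_W1p_star \<Omega> p :: (real^'n \<Rightarrow> ('y \<Rightarrow>\<^sub>L real)) set) = reshetnyak_sobolev_R1p \<Omega> p"
  using sobolev_W1p_star_subset_reshetnyak[OF assms(1,3)]
    reshetnyak_subset_sobolev_W1p_star[OF assms]
  by (rule equalityI)

end
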